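(* Let $S$ be an inverse semigroup and let $R$ be a unital ring (not necessarily commutative). Then the semigroup ring $RS$ is von Neumann regular if and only if all of the following hold: (1) $R$ is von Neumann regular; (2) $S$ is locally finite; (3) the order of each finite subgroup of $S$ is invertible in $R$.
   Context: A ring $A$ (not necessarily unital) is von Neumann regular if for every $a\in A$ there is $b\in A$ with $aba=a$. An inverse semigroup is a (nonempty) semigroup $S$ such that for every $s\in S$ there is a unique $s^*\in S$ with $ss^*s=s$ and $s^*ss^*=s^*$. $RS$ is the free left $R$-module with basis $S$ and multiplication $\sum_{s}c_ss\cdot\sum_t d_tt=\sum_{s,t}c_sd_t\,st$. A semigroup is locally finite if all its finitely generated subsemigroups are finite. A subgroup of $S$ is a subsemigroup that is a group under the induced operation (its identity is an idempotent of $S$, not necessarily an identity of $S$).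
   Formalization: The unital ring R is assumed nonzero (1 ≠ 0); for the zero ring the claim fails, since RS = 0 is von Neumann regular even when S (for example the group of integers) is not locally finite. *)

theory Defs
  imports "HOL-Library.Poly_Mapping" "HOL-Algebra.Group"
begin

definition von_neumann_regular :: "'a::ring itself \<Rightarrow> bool" where
  "von_neumann_regular _ \<longleftrightarrow> (\<forall>a::'a. \<exists>b. a * b * a = a)"

class inverse_semigroup = semigroup_mult +
  assumes ex1_semigroup_inverse: "\<exists>!t. s * t * s = s \<and> t * s * t = t"

inductive_set generated_subsemigroup :: "'s::semigroup_mult set \<Rightarrow> 's set"
  for A :: "'s set" where
  generator: "x \<in> A \<Longrightarrow> x \<in> generated_subsemigroup A"
| mult: "x \<in> generated_subsemigroup A \<Longrightarrow> y \<in> generated_subsemigroup A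
    \<Longrightarrow> x * y \<in> generated_subsemigroup A"

definition locally_finite_semigroup :: "'s::semigroup_mult itself \<Rightarrow> bool" where
  "locally_finite_semigroup _ \<longleftrightarrow>
    (\<forall>A::'s set. finite A \<longrightarrow> finite (generated_subsemigroup A))"

text \<open>The identity \<open>e\<close> of a subgroup need not be an identity of the ambient semigroup.\<close>

definition subgroup_of_semigroup :: "'s::semigroup_mult set \<Rightarrow> bool" where
  "subgroup_of_semigroup G \<longleftrightarrow>
    (\<exists>e. Group.group \<lparr>carrier = G, monoid.mult = (*), one = e\<rparr>)"


section \<open>Semigroup rings\<close>

text \<open>
  The library multiplication on \<open>'s \<Rightarrow>\<^sub>0 'r\<close> requires the exponents to form an additive monoid.
  A semigroup need not have an identity, so the convolution product is defined here on a copy of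
  the type of finitely supported functions. A function \<open>f\<close> stands for the formal sum of
  the elements \<open>s\<close> with coefficients \<open>Poly_Mapping.lookup f s\<close>.
\<close>

definition convolution ::
    "('s::semigroup_mult \<Rightarrow>\<^sub>0 'r::ring) \<Rightarrow> ('s \<Rightarrow>\<^sub>0 'r) \<Rightarrow> ('s \<Rightarrow>\<^sub>0 'r)" where
  "convolution f g = (\<Sum>s\<in>Poly_Mapping.keys f. \<Sum>t\<in>Poly_Mapping.keys g.
        Poly_Mapping.single (s * t) (Poly_Mapping.lookup f s * Poly_Mapping.lookup g t))"

lemma convolution_superset:
  assumes "finite A" "finite B" "Poly_Mapping.keys f \<subseteq> A" "Poly_Mapping.keys g \<subseteq> B"
  shows "convolution f g = (\<Sum>s\<in>A. \<Sum>t\<in>B.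
        Poly_Mapping.single (s * t) (Poly_Mapping.lookup f s * Poly_Mapping.lookup g t))"
proof -
  have "(\<Sum>t\<in>B.
        Poly_Mapping.single (s * t) (Poly_Mapping.lookup f s * Poly_Mapping.lookup g t))
      = (\<Sum>t\<in>Poly_Mapping.keys g.
        Poly_Mapping.single (s * t) (Poly_Mapping.lookup f s * Poly_Mapping.lookup g t))" for s
    by (rule sum.mono_neutral_right) (use assms in \<open>auto simp: in_keys_iff\<close>)
  then have "(\<Sum>s\<in>A. \<Sum>t\<in>B.
        Poly_Mapping.single (s * t) (Poly_Mapping.lookup f s * Poly_Mapping.lookup g t))
      = (\<Sum>s\<in>A. \<Sum>t\<in>Poly_Mapping.keys g.
        Poly_Mapping.single (s * t) (Poly_Mapping.lookup f s * Poly_Mapping.lookup g t))"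
    by simp
  also have "\<dots> = convolution f g"
    unfolding convolution_def
    by (rule sum.mono_neutral_right) (use assms in \<open>auto simp: in_keys_iff\<close>)
  finally show ?thesis by simp
qed

lemma convolution_add_left:
  "convolution (f + g) h = convolution f h + convolution g h"
proof -
  let ?A = "Poly_Mapping.keys f \<union> Poly_Mapping.keys g" and ?B = "Poly_Mapping.keys h"
  have "Poly_Mapping.keys (f + g) \<subseteq> ?A" by (rule keys_add)
  then show ?thesis
    by (simp add: convolution_superset[of ?A ?B] lookup_add distrib_right single_add sum.distrib)
qed

lemma convolution_add_right:
  "convolution f (g + h) = convolution f g + convolution f h"
proof -
  let ?A = "Poly_Mapping.keys f" and ?B = "Poly_Mapping.keys g \<union> Poly_Mapping.keys h"
  have "Poly_Mapping.keys (g + h) \<subseteq> ?B" by (rule keys_add)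
  then show ?thesis
    by (simp add: convolution_superset[of ?A ?B] lookup_add distrib_left single_add sum.distrib)
qed

lemma convolution_zero [simp]: "convolution 0 f = 0" "convolution f 0 = 0"
  by (simp_all add: convolution_def)

lemma convolution_sum_left: "convolution (sum F I) h = (\<Sum>i\<in>I. convolution (F i) h)"
  by (induction I rule: infinite_finite_induct) (simp_all add: convolution_add_left)

lemma convolution_sum_right: "convolution f (sum F I) = (\<Sum>i\<in>I. convolution f (F i))"
  by (induction I rule: infinite_finite_induct) (simp_all add: convolution_add_right)

lemma convolution_single [simp]:
  "convolution (Poly_Mapping.single s a) (Poly_Mapping.single t b) =
    Poly_Mapping.single (s * t) (a * b)"
  by (simp add: convolution_superset[of "{s}" "{t}"])

lemma sum_single_lookup:
  "(\<Sum>s\<in>Poly_Mapping.keys f. Poly_Mapping.single s (Poly_Mapping.lookup f s)) = f"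
  by (rule poly_mapping_eqI) (simp add: lookup_sum lookup_single when_def in_keys_iff)

lemma convolution_assoc: "convolution (convolution f g) h = convolution f (convolution g h)"
proof -
  let ?S = "\<lambda>f. \<Sum>s\<in>Poly_Mapping.keys f. Poly_Mapping.single s (Poly_Mapping.lookup f s)"
  have "convolution (convolution (?S f) (?S g)) (?S h)
      = convolution (?S f) (convolution (?S g) (?S h))"
    by (simp only: convolution_sum_left convolution_sum_right convolution_single mult.assoc)
  then show ?thesis by (simp only: sum_single_lookup)
qed

typedef (overloaded) ('s, 'r) semigroup_ring = "UNIV :: ('s::semigroup_mult \<Rightarrow>\<^sub>0 'r::ring) set"
  morphisms coefficients Abs_semigroup_ring
  by simp

setup_lifting type_definition_semigroup_ring

instantiation semigroup_ring :: (semigroup_mult, ring) ring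
begin

lift_definition zero_semigroup_ring :: "('a, 'b) semigroup_ring" is 0 .

lift_definition plus_semigroup_ring ::
  "('a, 'b) semigroup_ring \<Rightarrow> ('a, 'b) semigroup_ring \<Rightarrow> ('a, 'b) semigroup_ring" is "(+)" .

lift_definition uminus_semigroup_ring ::
  "('a, 'b) semigroup_ring \<Rightarrow> ('a, 'b) semigroup_ring" is uminus .

lift_definition minus_semigroup_ring ::
  "('a, 'b) semigroup_ring \<Rightarrow> ('a, 'b) semigroup_ring \<Rightarrow> ('a, 'b) semigroup_ring" is "(-)" .

lift_definition times_semigroup_ring ::
  "('a, 'b) semigroup_ring \<Rightarrow> ('a, 'b) semigroup_ring \<Rightarrow> ('a, 'b) semigroup_ring" is convolution .

instance
  by standard
    (transfer, simp add: convolution_assoc convolution_add_left convolution_add_right algebra_simps)+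

end

end

theory Submission
  imports Defs "HOL-Library.Function_Algebras"
begin

text \<open>
  \<^emph>\<open>Necessity.\<close> The augmentation maps the semigroup ring onto \<open>R\<close>. A quasi-inverse of the sum of
  the elements of a finite subgroup yields an inverse of its order. For local finiteness, let \<open>T\<close>
  be a finitely generated inverse subsemigroup, with a finite set of generators closed under
  inversion. In a regular ring some element \<open>f\<close> of the left ideal generated by the
  \<open>g - g * g\<^sup>\<star>\<close>, with \<open>g\<close> a generator, satisfies \<open>(g - g * g\<^sup>\<star>) * f = g - g * g\<^sup>\<star>\<close>. The left
  \<open>T\<close>-invariance and the finite support of \<open>1 - f\<close> bound the sizes of all orbits of \<open>T\<close> acting on
  its idempotents by partial bijections. Up to isomorphism only finitely many labelled graphs
  arise as such orbits, and they separate the elements of \<open>T\<close>, so \<open>T\<close> is finite.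

  \<^emph>\<open>Sufficiency.\<close> An element lies in the ring of a finite inverse subsemigroup \<open>T\<close>. By induction
  over the ideals of \<open>T\<close> and since \<open>a\<close> is regular as soon as some \<open>a - a * b * a\<close> is, it suffices
  to find a quasi-inverse modulo the ideal that remains after removing one \<open>\<D>\<close>-class. There the
  ring is a ring of matrices invariant under a finite group; matrices over \<open>R\<close> have
  quasi-inverses, which can be averaged over the group.
\<close>

subsection \<open>Inverse semigroups\<close>

definition star :: "'s::inverse_semigroup \<Rightarrow> 's" ("_\<^sup>\<star>" [1000] 1000) where
  "s\<^sup>\<star> = (THE t. s * t * s = s \<and> t * s * t = t)"

lemma star_props: "s * s\<^sup>\<star> * s = s \<and> s\<^sup>\<star> * s * s\<^sup>\<star> = s\<^sup>\<star>" for s :: "'s::inverse_semigroup"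
  unfolding star_def by (rule theI'[OF ex1_semigroup_inverse])

lemma mult_star_mult [simp]:
  fixes s :: "'s::inverse_semigroup"
  shows "s * (s\<^sup>\<star> * s) = s" "s\<^sup>\<star> * (s * s\<^sup>\<star>) = s\<^sup>\<star>"
    "s * (s\<^sup>\<star> * (s * t)) = s * t" "s\<^sup>\<star> * (s * (s\<^sup>\<star> * t)) = s\<^sup>\<star> * t"
proof -
  show 1: "s * (s\<^sup>\<star> * s) = s" "s\<^sup>\<star> * (s * s\<^sup>\<star>) = s\<^sup>\<star>"
    using star_props[of s] by (simp_all add: mult.assoc)
  show "s * (s\<^sup>\<star> * (s * t)) = s * t" "s\<^sup>\<star> * (s * (s\<^sup>\<star> * t)) = s\<^sup>\<star> * t"
    using arg_cong[OF 1(1), of "\<lambda>x. x * t"] arg_cong[OF 1(2), of "\<lambda>x. x * t"]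
    by (simp_all add: mult.assoc)
qed

lemma star_unique:
  fixes s :: "'s::inverse_semigroup"
  assumes "s * t * s = s" "t * s * t = t"
  shows "s\<^sup>\<star> = t"
  using assms star_props[of s] ex1_semigroup_inverse[of s] by blast

lemma star_star [simp]: "s\<^sup>\<star>\<^sup>\<star> = s" for s :: "'s::inverse_semigroup"
  by (rule star_unique) (simp_all add: mult.assoc)

lemma star_idem: "e * e = e \<Longrightarrow> e\<^sup>\<star> = e" for e :: "'s::inverse_semigroup"
  by (rule star_unique) simp_all

text \<open>The inverse \<open>?x\<close> of \<open>e * f\<close> equals \<open>f * ?x * e\<close>,
  which is idempotent. So \<open>?x\<close> is its own inverse and therefore equals
  \<open>e * f\<close>.\<close>

lemma idem_mult_idem:
  fixes e f :: "'s::inverse_semigroup"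
  assumes e: "e * e = e" and f: "f * f = f"
  shows "(e * f) * (e * f) = e * f"
proof -
  let ?x = "(e * f)\<^sup>\<star>"
  have ee: "e * (e * t) = e * t" and ff: "f * (f * t) = f * t" for t
    using e f by (simp_all flip: mult.assoc)
  have x1: "e * (f * (?x * (e * f))) = e * f" and x2: "?x * (e * (f * ?x)) = ?x"
    using star_props[of "e * f"] by (simp_all add: mult.assoc)
  have x2': "?x * (e * (f * (?x * t))) = ?x * t" for t
    using arg_cong[OF x2, of "\<lambda>x. x * t"] by (simp add: mult.assoc)
  have "?x = f * ?x * e"
    by (rule star_unique) (simp_all add: mult.assoc ee ff x1 x2')
  moreover have "(f * ?x * e) * (f * ?x * e) = f * ?x * e"
    by (simp add: mult.assoc x2')
  ultimately have "?x * ?x = ?x" by metis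
  then have "?x\<^sup>\<star> = ?x" by (rule star_idem)
  then show ?thesis
    using \<open>?x * ?x = ?x\<close> by simp
qed

text \<open>Both products are idempotent, so \<open>f * e\<close> satisfies the equations for the
  inverse of \<open>e * f\<close>, while an idempotent is its own inverse.\<close>

lemma idem_commute:
  fixes e f :: "'s::inverse_semigroup"
  assumes e: "e * e = e" and f: "f * f = f"
  shows "e * f = f * e"
proof -
  have ee: "e * (e * t) = e * t" and ff: "f * (f * t) = f * t" for t
    using e f by (simp_all flip: mult.assoc)
  note ef = idem_mult_idem[OF e f] and fe = idem_mult_idem[OF f e]
  have "(e * f)\<^sup>\<star> = f * e"
    by (rule star_unique) (use ef fe in \<open>simp_all add: mult.assoc ee ff\<close>)
  then show ?thesis using star_idem[OF ef] by simp
qed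

lemma idem_star_mult [simp]:
  fixes s :: "'s::inverse_semigroup"
  shows "(s\<^sup>\<star> * s) * (s\<^sup>\<star> * s) = s\<^sup>\<star> * s" "(s * s\<^sup>\<star>) * (s * s\<^sup>\<star>) = s * s\<^sup>\<star>"
  by (simp_all add: mult.assoc)

lemma proj_commute:
  fixes s t :: "'s::inverse_semigroup"
  shows "s\<^sup>\<star> * (s * (t * t\<^sup>\<star>)) = t * (t\<^sup>\<star> * (s\<^sup>\<star> * s))"
    "s\<^sup>\<star> * (s * (t * (t\<^sup>\<star> * r))) = t * (t\<^sup>\<star> * (s\<^sup>\<star> * (s * r)))"
proof -
  show 1: "s\<^sup>\<star> * (s * (t * t\<^sup>\<star>)) = t * (t\<^sup>\<star> * (s\<^sup>\<star> * s))"
    using idem_commute[OF idem_star_mult(1)[of s] idem_star_mult(2)[of t]]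
    by (simp add: mult.assoc)
  show "s\<^sup>\<star> * (s * (t * (t\<^sup>\<star> * r))) = t * (t\<^sup>\<star> * (s\<^sup>\<star> * (s * r)))"
    using arg_cong[OF 1, of "\<lambda>x. x * r"] by (simp add: mult.assoc)
qed

lemma star_mult [simp]: "(s * t)\<^sup>\<star> = t\<^sup>\<star> * s\<^sup>\<star>" for s t :: "'s::inverse_semigroup"
proof (rule star_unique)
  have "s * (t * (t\<^sup>\<star> * (s\<^sup>\<star> * (s * t)))) = s * (s\<^sup>\<star> * (s * (t * (t\<^sup>\<star> * t))))"
    by (simp only: proj_commute)
  then show "s * t * (t\<^sup>\<star> * s\<^sup>\<star>) * (s * t) = s * t" by (simp add: mult.assoc)
  have "t\<^sup>\<star> * (s\<^sup>\<star> * (s * (t * (t\<^sup>\<star> * s\<^sup>\<star>)))) = t\<^sup>\<star> * (t * (t\<^sup>\<star> * (s\<^sup>\<star> * (s * s\<^sup>\<star>))))"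
    by (simp only: proj_commute)
  then show "t\<^sup>\<star> * s\<^sup>\<star> * (s * t) * (t\<^sup>\<star> * s\<^sup>\<star>) = t\<^sup>\<star> * s\<^sup>\<star>" by (simp add: mult.assoc)
qed

text \<open>\<open>defined_at s x\<close>: the range projection of \<open>x\<close> lies below the domain projection
  of \<open>s\<close>, so that left multiplication by \<open>s\<close> loses no information about \<open>x\<close>.\<close>

definition defined_at :: "'s::inverse_semigroup \<Rightarrow> 's \<Rightarrow> bool" where
  "defined_at s x \<longleftrightarrow> s\<^sup>\<star> * s * x = x"

text \<open>This makes left multiplication, restricted by \<open>defined_at\<close>, an action by
  partial maps in which products act by composition.\<close>

lemma defined_at_mult:
  "defined_at (s * t) x \<longleftrightarrow> defined_at t x \<and> defined_at s (t * x)"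
proof
  assume "defined_at (s * t) x"
  then have x: "t\<^sup>\<star> * (s\<^sup>\<star> * (s * (t * x))) = x"
    by (simp add: defined_at_def mult.assoc)
  have "t\<^sup>\<star> * (t * x) = x"
    using x by (metis mult_star_mult(4))
  moreover have "s\<^sup>\<star> * (s * (t * x)) = t * (t\<^sup>\<star> * (s\<^sup>\<star> * (s * (t * x))))"
    by (metis mult_star_mult(3) proj_commute(2))
  ultimately show "defined_at t x \<and> defined_at s (t * x)"
    using x by (simp add: defined_at_def mult.assoc)
qed (simp add: defined_at_def mult.assoc)

subsection \<open>Semigroup rings and sums of coefficients\<close>

abbreviation coeff :: "('s::semigroup_mult, 'r::ring) semigroup_ring \<Rightarrow> 's \<Rightarrow> 'r" where
  "coeff a s \<equiv> Poly_Mapping.lookup (coefficients a) s"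

abbreviation supp :: "('s::semigroup_mult, 'r::ring) semigroup_ring \<Rightarrow> 's set" where
  "supp a \<equiv> Poly_Mapping.keys (coefficients a)"

lift_definition atom :: "'s::semigroup_mult \<Rightarrow> 'r::ring \<Rightarrow> ('s, 'r) semigroup_ring" is
  Poly_Mapping.single .

text \<open>Single coefficients, the augmentation and the functionals on orbits and germs are all
  instances. Multiplication by an atom merely shifts the predicate and scales the value.\<close>

definition coeff_sum :: "('s::semigroup_mult \<Rightarrow> bool) \<Rightarrow> ('s, 'r::ring) semigroup_ring \<Rightarrow> 'r" where
  "coeff_sum P a = (\<Sum>s\<in>supp a. if P s then coeff a s else 0)"

lemma coefficients_simps [simp]:
  "coefficients 0 = 0" "coefficients (a + b) = coefficients a + coefficients b"
  "coefficients (a - b) = coefficients a - coefficients b"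
  "coefficients (atom s c) = Poly_Mapping.single s c"
  by (fact zero_semigroup_ring.rep_eq plus_semigroup_ring.rep_eq minus_semigroup_ring.rep_eq
      atom.rep_eq)+

lemma semigroup_ring_eqI: "(\<And>s. coeff a s = coeff b s) \<Longrightarrow> a = b"
  by transfer (rule poly_mapping_eqI)

lemma coeff_sum_superset:
  assumes "finite F" "supp a \<subseteq> F"
  shows "coeff_sum P a = (\<Sum>s\<in>F. if P s then coeff a s else 0)"
  unfolding coeff_sum_def
  by (rule sum.mono_neutral_left) (use assms in \<open>auto simp: in_keys_iff\<close>)

lemma coeff_sum_add: "coeff_sum P (a + b) = coeff_sum P a + coeff_sum P b"
proof -
  have "supp (a + b) \<subseteq> supp a \<union> supp b" by (simp add: keys_add)
  then show ?thesis
    by (simp add: coeff_sum_superset[where F = "supp a \<union> supp b"] lookup_add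
        flip: sum.distrib cong: if_cong) (rule sum.cong, auto)
qed

lemma coeff_sum_zero [simp]: "coeff_sum P 0 = 0"
  by (simp add: coeff_sum_def)

lemma coeff_sum_diff: "coeff_sum P (a - b) = coeff_sum P a - coeff_sum P b"
  using coeff_sum_add[of P "a - b" b] by (simp add: algebra_simps)

lemma coeff_sum_sum: "coeff_sum P (sum a I) = (\<Sum>i\<in>I. coeff_sum P (a i))"
  by (induction I rule: infinite_finite_induct) (simp_all add: coeff_sum_add)

lemma coeff_sum_atom [simp]: "coeff_sum P (atom s c) = (if P s then c else 0)"
  by (subst coeff_sum_superset[of "{s}"]) (auto simp: lookup_single)

lemma coeff_sum_eq: "coeff_sum (\<lambda>t. t = s) a = coeff a s"
  unfolding coeff_sum_def by (simp add: in_keys_iff sum.delta')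

lemma sum_atom: "a = (\<Sum>s\<in>supp a. atom s (coeff a s))"
proof (rule semigroup_ring_eqI)
  fix s
  have "coeff_sum (\<lambda>t. t = s) (\<Sum>s\<in>supp a. atom s (coeff a s)) = coeff_sum (\<lambda>t. t = s) a"
    by (simp add: coeff_sum_sum) (simp add: coeff_sum_def)
  then show "coeff a s = coeff (\<Sum>s\<in>supp a. atom s (coeff a s)) s"
    by (simp add: coeff_sum_eq)
qed

lemma atom_mult [simp]: "atom s c * atom t d = atom (s * t) (c * d)"
  by transfer simp

lemma additive_eqI:
  fixes F G :: "('s::semigroup_mult, 'r::ring) semigroup_ring \<Rightarrow> 'm::ab_group_add"
  assumes "\<And>a b. F (a + b) = F a + F b" "\<And>a b. G (a + b) = G a + G b"
    and atom: "\<And>s c. F (atom s c) = G (atom s c)"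
  shows "F a = G a"
proof -
  have zero: "F 0 = 0" "G 0 = 0"
    using assms(1,2)[of 0 0] by simp_all
  have "F (\<Sum>s\<in>I. atom s (coeff a s)) = G (\<Sum>s\<in>I. atom s (coeff a s))" for I
    by (induction I rule: infinite_finite_induct) (simp_all add: assms zero)
  from this[of "supp a"] show ?thesis by (simp only: sum_atom[symmetric])
qed

lemma coeff_sum_atom_mult: "coeff_sum P (atom g c * b) = c * coeff_sum (\<lambda>t. P (g * t)) b"
  by (rule additive_eqI[of "\<lambda>b. coeff_sum P (atom g c * b)"])
    (simp_all add: coeff_sum_add algebra_simps)

lemma coeff_sum_mult_atom: "coeff_sum P (b * atom g c) = coeff_sum (\<lambda>t. P (t * g)) b * c"
  by (rule additive_eqI[of "\<lambda>b. coeff_sum P (b * atom g c)"])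
    (simp_all add: coeff_sum_add algebra_simps)

lemma coeff_sum_mult:
  "coeff_sum P (a * b) = (\<Sum>s\<in>supp a. coeff a s * coeff_sum (\<lambda>t. P (s * t)) b)"
proof -
  have "coeff_sum P ((\<Sum>s\<in>supp a. atom s (coeff a s)) * b) =
      (\<Sum>s\<in>supp a. coeff a s * coeff_sum (\<lambda>t. P (s * t)) b)"
    by (simp only: sum_distrib_right coeff_sum_sum coeff_sum_atom_mult)
  then show ?thesis by (simp only: sum_atom[symmetric])
qed

lemma supp_mult: "supp (a * b) \<subseteq> {s * t |s t. s \<in> supp a \<and> t \<in> supp b}"
proof
  fix u assume "u \<in> supp (a * b)"
  then have "coeff_sum (\<lambda>t. t = u) (a * b) \<noteq> 0"
    by (simp add: coeff_sum_eq in_keys_iff)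
  then have "(\<Sum>s\<in>supp a. coeff a s * coeff_sum (\<lambda>t. s * t = u) b) \<noteq> 0"
    by (simp only: coeff_sum_mult not_False_eq_True)
  then obtain s where s: "s \<in> supp a" "coeff a s * coeff_sum (\<lambda>t. s * t = u) b \<noteq> 0"
    by (rule sum.not_neutral_contains_not_neutral)
  then have "(\<Sum>t\<in>supp b. if s * t = u then coeff b t else 0) \<noteq> 0"
    by (auto simp: coeff_sum_def)
  then obtain t where "t \<in> supp b" "(if s * t = u then coeff b t else 0) \<noteq> 0"
    by (rule sum.not_neutral_contains_not_neutral)
  with s(1) show "u \<in> {s * t |s t. s \<in> supp a \<and> t \<in> supp b}"
    by (auto split: if_splits)
qed

subsection \<open>Necessity: the coefficient ring and subgroups\<close>

lemma von_neumann_regular_coefficients: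
  assumes "von_neumann_regular TYPE(('s::semigroup_mult, 'r::ring) semigroup_ring)"
  shows "von_neumann_regular TYPE('r)"
  unfolding von_neumann_regular_def
proof
  fix c :: 'r
  let ?aug = "coeff_sum (\<lambda>s::'s. True) :: _ \<Rightarrow> 'r"
  have mult: "?aug (a * b) = ?aug a * ?aug b" for a b
    by (subst coeff_sum_mult) (simp add: coeff_sum_def sum_distrib_right)
  \<comment> \<open>Types are nonempty, and any \<open>s\<close> will do because
    \<open>atom s c\<close> has augmentation \<open>c\<close>.\<close>
  obtain s :: 's where True by simp
  from assms obtain b where "atom s c * b * atom s c = atom s c"
    unfolding von_neumann_regular_def by metis
  then have "c * ?aug b * c = c"
    by (metis (mono_tags) mult coeff_sum_atom)
  then show "\<exists>b. c * b * c = c" ..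
qed

text \<open>If \<open>N\<close> is the sum of the elements of \<open>G\<close> and \<open>N * b * N = N\<close>, then the coefficient of
  the identity in \<open>N * b * N\<close> is a multiple of \<open>card G\<close>.\<close>

lemma card_subgroup_invertible:
  fixes G :: "'s::inverse_semigroup set"
  assumes reg: "von_neumann_regular TYPE(('s, 'r::ring_1) semigroup_ring)"
    and G: "subgroup_of_semigroup G" and fin: "finite G"
  shows "\<exists>u::'r. of_nat (card G) * u = 1 \<and> u * of_nat (card G) = 1"
proof -
  obtain e where "Group.group \<lparr>carrier = G, monoid.mult = (*), one = e\<rparr>"
    using G unfolding subgroup_of_semigroup_def by blast
  then interpret group "\<lparr>carrier = G, monoid.mult = (*), one = e\<rparr>" .
  let ?N = "\<Sum>g\<in>G. atom g (1::'r)"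
  obtain b where b: "?N * b * ?N = ?N"
    using reg unfolding von_neumann_regular_def by blast
  have eG: "e \<in> G" using one_closed by simp
  \<comment> \<open>The coefficient of \<open>k\<close> after multiplying \<open>b\<close> by
    \<open>e\<close> on both sides.\<close>
  let ?\<beta> = "\<lambda>k. coeff_sum (\<lambda>s. e * s * e = k) b"
  have inner: "(\<Sum>h\<in>G. coeff_sum (\<lambda>s. g * (s * h) = e) b) = (\<Sum>k\<in>G. ?\<beta> k)" if g: "g \<in> G" for g
  proof -
    let ?i = "\<lambda>h. m_inv \<lparr>carrier = G, monoid.mult = (*), one = e\<rparr> h"
    have iG: "?i h \<in> G" if "h \<in> G" for h using inv_closed[of h] that by simp
    have il: "?i h * h = e" "h * ?i h = e" if "h \<in> G" for h
      using l_inv[of h] r_inv[of h] that by simp_all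
    have one: "e * h = h" "h * e = h" if "h \<in> G" for h
      using l_one[of h] r_one[of h] that by simp_all
    have cl: "h * k \<in> G" if "h \<in> G" "k \<in> G" for h k
      using m_closed[of h k] that by simp
    have eq: "g * (s * h) = e \<longleftrightarrow> e * s * e = ?i g * ?i h" if h: "h \<in> G" for s h
    proof
      assume "g * (s * h) = e"
      then have "?i g * (g * (s * h)) * ?i h = ?i g * e * ?i h" by simp
      then have "(?i g * g) * s * (h * ?i h) = ?i g * (e * ?i h)" by (simp only: mult.assoc)
      then show "e * s * e = ?i g * ?i h" using il one iG g h by simp
    next
      assume "e * s * e = ?i g * ?i h"
      then have "g * (e * s * e) * h = g * (?i g * ?i h) * h" by simp
      then have "(g * e) * s * (e * h) = (g * ?i g) * (?i h * h)" by (simp only: mult.assoc)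
      then show "g * (s * h) = e" using il one g h eG by (simp add: mult.assoc)
    qed
    \<comment> \<open>For fixed \<open>g\<close>, the product of the two inverses runs exactly once
      through \<open>G\<close> with \<open>h\<close>, so the inner sum does not depend on
      \<open>g\<close>.\<close>
    have "bij_betw (\<lambda>h. ?i g * ?i h) G G"
    proof (rule bij_betw_byWitness[where f' = "\<lambda>k. ?i k * ?i g"])
      have "?i (?i g * ?i h) * ?i g = h" if "h \<in> G" for h
        using inv_mult_group[of "?i g" "?i h"] inv_inv[of g] inv_inv[of h] that g iG il(2)[of g] one
        by (simp add: mult.assoc)
      then show "\<forall>h\<in>G. ?i (?i g * ?i h) * ?i g = h" by blast
      have "?i g * ?i (?i k * ?i g) = k" if "k \<in> G" for k
        using inv_mult_group[of "?i k" "?i g"] inv_inv[of g] inv_inv[of k] that g iG il(1)[of g] one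
        by (simp flip: mult.assoc)
      then show "\<forall>k\<in>G. ?i g * ?i (?i k * ?i g) = k" by blast
    qed (use cl iG g in auto)
    from sum.reindex_bij_betw[OF this, of ?\<beta>] show ?thesis
      by (simp add: eq cong: sum.cong)
  qed
  have "1 = coeff_sum (\<lambda>s. s = e) ?N"
    using eG fin by (simp add: coeff_sum_sum)
  also have "\<dots> = coeff_sum (\<lambda>s. s = e) (?N * b * ?N)"
    by (simp only: b)
  also have "?N * b * ?N = (\<Sum>g\<in>G. \<Sum>h\<in>G. atom g 1 * (b * atom h 1))"
    by (simp add: sum_distrib_left sum_distrib_right mult.assoc) (rule sum.swap)
  also have "coeff_sum (\<lambda>s. s = e) \<dots> = (\<Sum>g\<in>G. \<Sum>h\<in>G. coeff_sum (\<lambda>s. g * (s * h) = e) b)"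
    by (simp add: coeff_sum_sum coeff_sum_atom_mult coeff_sum_mult_atom)
  also have "\<dots> = (\<Sum>g\<in>G. \<Sum>k\<in>G. ?\<beta> k)"
    by (rule sum.cong) (simp_all add: inner)
  also have "\<dots> = of_nat (card G) * (\<Sum>k\<in>G. ?\<beta> k)" by simp
  finally have "of_nat (card G) * (\<Sum>k\<in>G. ?\<beta> k) = 1" by simp
  \<comment> \<open>Images of natural numbers are central, so the right inverse is
    two-sided.\<close>
  then show ?thesis
    by (metis mult_of_nat_commute)
qed

subsection \<open>Necessity: local finiteness\<close>

lemma generated_subsemigroup_mono:
  assumes "A \<subseteq> B" shows "generated_subsemigroup A \<subseteq> generated_subsemigroup B"
proof
  fix x assume "x \<in> generated_subsemigroup A"
  then show "x \<in> generated_subsemigroup B"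
    by induction (use assms in \<open>auto intro: generated_subsemigroup.intros\<close>)
qed

lemma generated_subsemigroup_star:
  fixes A :: "'s::inverse_semigroup set"
  assumes "\<And>a. a \<in> A \<Longrightarrow> a\<^sup>\<star> \<in> A" and "x \<in> generated_subsemigroup A"
  shows "x\<^sup>\<star> \<in> generated_subsemigroup A"
  using assms(2) by induction (use assms(1) in \<open>auto intro: generated_subsemigroup.intros\<close>)

section \<open>Orbit graphs and a finiteness criterion\<close>

text \<open>For an idempotent \<open>e\<close> of an inverse subsemigroup \<open>T\<close> this is
  the L-class of \<open>e\<close> in \<open>T\<close>, the set of \<open>x \<in> T\<close> with
  \<open>x\<^sup>\<star> * x = e\<close>.\<close>

definition orbit :: "'s::inverse_semigroup set \<Rightarrow> 's \<Rightarrow> 's set" where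
  "orbit T e = (\<lambda>t. t * e) ` {t \<in> T. defined_at t e}"

text \<open>An element \<open>t\<close> is recovered from the \<open>A\<close>-labelled graph on the orbit of \<open>t\<^sup>\<star> * t\<close> with
  base point \<open>t\<^sup>\<star> * t\<close>, together with the vertex \<open>t\<close>; numbering the vertices of all orbits by
  \<open>{..<M}\<close> leaves finitely many possibilities.\<close>

lemma finite_generated_subsemigroup_if_bounded_orbits:
  fixes A :: "'s::inverse_semigroup set"
  assumes A: "finite A" "\<And>a. a \<in> A \<Longrightarrow> a\<^sup>\<star> \<in> A"
    and bounded: "\<And>t. t \<in> generated_subsemigroup A \<Longrightarrow>
      finite (orbit (generated_subsemigroup A) (t\<^sup>\<star> * t)) \<and>
      card (orbit (generated_subsemigroup A) (t\<^sup>\<star> * t)) \<le> M"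
  shows "finite (generated_subsemigroup A)"
proof -
  let ?T = "generated_subsemigroup A"
  let ?E = "(\<lambda>t. t\<^sup>\<star> * t) ` ?T"
  let ?V = "orbit ?T"
  have star: "t\<^sup>\<star> \<in> ?T" if "t \<in> ?T" for t
    using generated_subsemigroup_star A(2) that by blast
  have "\<forall>e\<in>?E. \<exists>\<nu>. \<nu> ` ?V e \<subseteq> {..<M} \<and> inj_on \<nu> (?V e)"
  proof
    fix e assume "e \<in> ?E"
    then have "finite (?V e)" "card (?V e) \<le> card {..<M}" using bounded by auto
    then show "\<exists>\<nu>. \<nu> ` ?V e \<subseteq> {..<M} \<and> inj_on \<nu> (?V e)"
      by (rule card_le_inj[OF _ finite_lessThan])
  qed
  from bchoice[OF this] obtain \<nu>
    where \<nu>: "\<forall>e\<in>?E. \<nu> e ` ?V e \<subseteq> {..<M} \<and> inj_on (\<nu> e) (?V e)" ..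
  have inj: "inj_on (\<nu> e) (?V e)" if "e \<in> ?E" for e
    using \<nu> that by blast
  have ran: "\<nu> e x < M" if "e \<in> ?E" "x \<in> ?V e" for e x
    using \<nu> that by blast
  define edges where
    "edges e = {(a, \<nu> e x, \<nu> e (a * x)) |a x. a \<in> A \<and> x \<in> ?V e \<and> defined_at a x}" for e
  have V_mult: "t * x \<in> ?V e" if "t \<in> ?T" "x \<in> ?V e" "defined_at t x" for t x e
  proof -
    from \<open>x \<in> ?V e\<close> obtain u where u: "u \<in> ?T" "defined_at u e" "x = u * e"
      unfolding orbit_def by auto
    then have "defined_at (t * u) e" "t * u \<in> ?T"
      using that by (auto simp: defined_at_mult intro: generated_subsemigroup.mult)
    then show ?thesis
      unfolding orbit_def u(3) by (auto simp: mult.assoc[symmetric])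
  qed
  have E_idem: "e * e = e" if "e \<in> ?E" for e
    using that by (auto simp: mult.assoc)
  have E_V: "e \<in> ?V e" if "e \<in> ?E" for e
    unfolding orbit_def
  proof (rule image_eqI)
    show "e = e * e" using E_idem[OF that] by simp
    show "e \<in> {t \<in> ?T. defined_at t e}"
      using that E_idem[OF that] star_idem[OF E_idem[OF that]] star
      by (auto simp: defined_at_def intro: generated_subsemigroup.mult)
  qed
  \<comment> \<open>When two orbits have equal numbered graphs, a path spelled by \<open>t\<close>
    can be followed from equally numbered vertices in both, with equally numbered ends.\<close>
  have transport: "\<forall>x x'. x \<in> ?V e \<longrightarrow> x' \<in> ?V e' \<longrightarrow> \<nu> e x = \<nu> e' x' \<longrightarrow> defined_at t x \<longrightarrow>
      defined_at t x' \<and> \<nu> e (t * x) = \<nu> e' (t * x')"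
    if t: "t \<in> ?T" and e: "e \<in> ?E" "e' \<in> ?E" "edges e = edges e'" for t e e'
    using t
  proof induction
    case (generator a)
    show ?case
    proof (intro allI impI)
      fix x x' assume x: "x \<in> ?V e" "x' \<in> ?V e'" "\<nu> e x = \<nu> e' x'" "defined_at a x"
      then have "(a, \<nu> e x, \<nu> e (a * x)) \<in> edges e'"
        using generator e(3) unfolding edges_def by blast
      then obtain x'' where x'': "x'' \<in> ?V e'" "\<nu> e x = \<nu> e' x''"
        "\<nu> e (a * x) = \<nu> e' (a * x'')" "defined_at a x''"
        unfolding edges_def by auto
      then have "x'' = x'"
        using inj[OF e(2)] x by (simp add: inj_on_def)
      then show "defined_at a x' \<and> \<nu> e (a * x) = \<nu> e' (a * x')" using x'' by simp
    qed
  next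
    case (mult s t)
    show ?case
    proof (intro allI impI)
      fix x x' assume x: "x \<in> ?V e" "x' \<in> ?V e'" "\<nu> e x = \<nu> e' x'" "defined_at (s * t) x"
      then have d: "defined_at t x" "defined_at s (t * x)" by (simp_all add: defined_at_mult)
      then have t: "defined_at t x'" "\<nu> e (t * x) = \<nu> e' (t * x')"
        using mult.IH(2) x by blast+
      then have "defined_at s (t * x') \<and> \<nu> e (s * (t * x)) = \<nu> e' (s * (t * x'))"
        using mult.IH(1) V_mult[OF mult.hyps(2)] x d by blast
      then show "defined_at (s * t) x' \<and> \<nu> e (s * t * x) = \<nu> e' (s * t * x')"
        using t by (simp add: defined_at_mult mult.assoc)
    qed
  qed
  let ?code = "\<lambda>t. (\<nu> (t\<^sup>\<star> * t) (t\<^sup>\<star> * t), edges (t\<^sup>\<star> * t), \<nu> (t\<^sup>\<star> * t) t)"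
  have t_V: "t \<in> ?V (t\<^sup>\<star> * t)" if "t \<in> ?T" for t
    unfolding orbit_def
    by (rule image_eqI[of _ _ t]) (use that in \<open>auto simp: defined_at_def mult.assoc\<close>)
  \<comment> \<open>Each element is defined at its own domain idempotent; transport between the base
    points makes \<open>s\<close> defined at that of \<open>t\<close>. By symmetry the idempotents
    agree.\<close>
  have le: "s\<^sup>\<star> * s * (t\<^sup>\<star> * t) = t\<^sup>\<star> * t" if st: "s \<in> ?T" "t \<in> ?T" "?code s = ?code t" for s t
  proof -
    have "defined_at s (s\<^sup>\<star> * s)" by (simp add: defined_at_def mult.assoc)
    then have "defined_at s (t\<^sup>\<star> * t)"
      using transport[of s "s\<^sup>\<star> * s" "t\<^sup>\<star> * t"] E_V[of "s\<^sup>\<star> * s"] E_V[of "t\<^sup>\<star> * t"] st by simp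
    then show ?thesis by (simp add: defined_at_def)
  qed
  have "inj_on ?code ?T"
  proof (rule inj_onI)
    fix s t assume st: "s \<in> ?T" "t \<in> ?T" "?code s = ?code t"
    have "s\<^sup>\<star> * s = t\<^sup>\<star> * t"
      using le[OF st] le[OF st(2,1) st(3)[symmetric]]
        idem_commute[of "s\<^sup>\<star> * s" "t\<^sup>\<star> * t"] by simp
    moreover from this have "\<nu> (t\<^sup>\<star> * t) s = \<nu> (t\<^sup>\<star> * t) t" using st(3) by simp
    ultimately show "s = t"
      using inj[of "t\<^sup>\<star> * t"] t_V[OF st(1)] t_V[OF st(2)] st(2) by (simp add: inj_on_def)
  qed
  moreover have "?code ` ?T \<subseteq> {..<M} \<times> Pow (A \<times> {..<M} \<times> {..<M}) \<times> {..<M}"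
  proof (rule image_subsetI)
    fix t assume t: "t \<in> ?T"
    then have "edges (t\<^sup>\<star> * t) \<subseteq> A \<times> {..<M} \<times> {..<M}"
      unfolding edges_def using ran[of "t\<^sup>\<star> * t"] V_mult[OF generated_subsemigroup.generator]
      by auto
    then show "?code t \<in> {..<M} \<times> Pow (A \<times> {..<M} \<times> {..<M}) \<times> {..<M}"
      using t ran t_V E_V by simp
  qed
  moreover have "finite ({..<M} \<times> Pow (A \<times> {..<M} \<times> {..<M}) \<times> {..<M})"
    using A(1) by simp
  ultimately show ?thesis
    using finite_imageD finite_subset by blast
qed

section \<open>Right units in left ideals and invariant functions on germs\<close>

text \<open>For \<open>c = a - a * f\<close> with \<open>c * d * c = c\<close>, the new unit
  \<open>f'\<close> comes from the formal identity \<open>1 - f' = (1 - f) * (1 - d * c)\<close>: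
  the first factor kills \<open>F\<close> and sends \<open>a\<close> to \<open>c\<close>, which the
  second kills.\<close>

lemma regular_common_right_unit:
  fixes J :: "'a::ring set"
  assumes reg: "von_neumann_regular TYPE('a)"
    and J: "0 \<in> J" "\<And>a b. a \<in> J \<Longrightarrow> b \<in> J \<Longrightarrow> a + b \<in> J" "\<And>a b. a \<in> J \<Longrightarrow> b \<in> J \<Longrightarrow> a - b \<in> J"
      "\<And>r a. a \<in> J \<Longrightarrow> r * a \<in> J"
    and F: "finite F" "F \<subseteq> J"
  shows "\<exists>f\<in>J. \<forall>a\<in>F. a * f = a"
  using F
proof (induction F)
  case empty
  then show ?case using J by auto
next
  case (insert a F)
  then obtain f where f: "f \<in> J" "\<And>b. b \<in> F \<Longrightarrow> b * f = b" by auto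
  obtain d where d: "(a - a * f) * d * (a - a * f) = a - a * f"
    using reg unfolding von_neumann_regular_def by blast
  let ?c = "a - a * f"
  have "b * (f + d * ?c - f * (d * ?c)) = b * f + (b - b * f) * d * ?c" for b
    by (simp add: algebra_simps)
  then have "\<forall>b\<in>insert a F. b * (f + d * ?c - f * (d * ?c)) = b"
    using f(2) d by (auto simp: mult.assoc)
  moreover have "f + d * ?c - f * (d * ?c) \<in> J"
    using insert.prems f(1) by (intro J) auto
  ultimately show ?case by blast
qed

text \<open>The \<open>R\<close>-linear functional on the semigroup ring whose value is the sum of the coefficients at
  \<open>same_orbit T e\<close> is constant on right \<open>T\<close>-orbits: for \<open>t \<in> T\<close> it does not distinguish
  \<open>s * t\<close> from \<open>s * (t * t\<^sup>\<star>)\<close>.\<close>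

definition same_orbit :: "'s::inverse_semigroup set \<Rightarrow> 's \<Rightarrow> 's \<Rightarrow> bool" where
  "same_orbit T e s \<longleftrightarrow> (\<exists>t\<in>T. e * (t * t\<^sup>\<star>) = e \<and> e * s = e * t)"

text \<open>A witness \<open>t\<close> for one side becomes \<open>t * g\<^sup>\<star>\<close> or
  \<open>t * g\<close> for the other. It keeps its range condition at \<open>e\<close> because
  \<open>e * t\<close> equals a product that already ends in \<open>g\<close> or
  \<open>g\<^sup>\<star>\<close>.\<close>

lemma same_orbit_mult:
  fixes T :: "'s::inverse_semigroup set"
  assumes T: "\<And>s t. s \<in> T \<Longrightarrow> t \<in> T \<Longrightarrow> s * t \<in> T" "g \<in> T" "g\<^sup>\<star> \<in> T"
  shows "same_orbit T e (s * g) \<longleftrightarrow> same_orbit T e (s * (g * g\<^sup>\<star>))"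
proof
  assume "same_orbit T e (s * g)"
  then obtain t where t: "t \<in> T" "e * (t * t\<^sup>\<star>) = e" "e * (s * g) = e * t"
    unfolding same_orbit_def by auto
  have t3: "e * (s * (g * x)) = e * (t * x)" for x
    using arg_cong[OF t(3), of "\<lambda>y. y * x"] by (simp add: mult.assoc)
  have "e * ((t * g\<^sup>\<star>) * (t * g\<^sup>\<star>)\<^sup>\<star>) = e * (s * (g * (g\<^sup>\<star> * (g * t\<^sup>\<star>))))"
    unfolding t3 by (simp add: mult.assoc)
  also have "\<dots> = e" using t(2) by (simp add: t3)
  finally show "same_orbit T e (s * (g * g\<^sup>\<star>))"
    unfolding same_orbit_def using T t by (intro bexI[of _ "t * g\<^sup>\<star>"]) (auto simp: t3)
next
  assume "same_orbit T e (s * (g * g\<^sup>\<star>))"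
  then obtain t where t: "t \<in> T" "e * (t * t\<^sup>\<star>) = e" "e * (s * (g * g\<^sup>\<star>)) = e * t"
    unfolding same_orbit_def by auto
  have t3: "e * (s * (g * (g\<^sup>\<star> * x))) = e * (t * x)" for x
    using arg_cong[OF t(3), of "\<lambda>y. y * x"] by (simp add: mult.assoc)
  have "e * ((t * g) * (t * g)\<^sup>\<star>) = e * (s * (g * (g\<^sup>\<star> * (g * (g\<^sup>\<star> * t\<^sup>\<star>)))))"
    unfolding t3 by (simp add: mult.assoc)
  also have "\<dots> = e * (s * (g * (g\<^sup>\<star> * t\<^sup>\<star>)))" by simp
  also have "\<dots> = e" using t(2) by (simp only: t3)
  finally show "same_orbit T e (s * g)"
    unfolding same_orbit_def using T t t3[of g] by (intro bexI[of _ "t * g"]) auto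
qed


text \<open>Grouping the elements \<open>s\<close> by the germ \<open>x = e * s\<close>, only the
  germ \<open>e\<close> contributes, since \<open>e\<close> is the only idempotent with range
  \<open>e\<close>. Used contrapositively: a sum different from 1 yields a germ where
  \<open>zero\<close> fails.\<close>

lemma sum_coeff_fibre:
  fixes f :: "('s::inverse_semigroup, 'r::ring_1) semigroup_ring"
  assumes e: "e * e = e" "same_orbit T e e"
    and zero: "\<And>x. x * x\<^sup>\<star> = e \<Longrightarrow>
      coeff_sum (\<lambda>s. x * x\<^sup>\<star> * s = x) f = (if x * x = x then 1 else 0)"
  shows "coeff_sum (same_orbit T e) f = 1"
proof -
  \<comment> \<open>The finitely many germs met by the support of \<open>f\<close>, with
    \<open>e\<close> added so that the term 1 is present in every case.\<close>
  define X where "X = insert e ((\<lambda>s. e * s) ` {s \<in> supp f. same_orbit T e s})"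
  have estar: "e\<^sup>\<star> = e" using star_idem[OF e(1)] .
  have range: "x * x\<^sup>\<star> = e \<and> same_orbit T e x \<and> e * x = x" if x: "x \<in> X" for x
  proof (cases "x = e")
    case False
    then obtain s where s: "same_orbit T e s" "x = e * s" using x unfolding X_def by auto
    then obtain t where t: "t \<in> T" "e * (t * t\<^sup>\<star>) = e" "x = e * t"
      unfolding same_orbit_def by auto
    have ex: "e * x = x" using s(2) e(1) by (simp flip: mult.assoc)
    have "x * x\<^sup>\<star> = e * (t * t\<^sup>\<star>) * e" unfolding t(3) by (simp add: mult.assoc estar)
    then show ?thesis
      using t ex e(1) unfolding same_orbit_def by auto
  qed (use e estar in auto)
  have idem: "x * x = x \<longleftrightarrow> x = e" if "x \<in> X" for x
    using range[OF that] star_idem[of x] e(1) by auto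
  have mem: "same_orbit T e s \<longleftrightarrow> e * s \<in> X" if "s \<in> supp f" for s
  proof
    assume "e * s \<in> X"
    then have "same_orbit T e (e * s)" using range by blast
    then show "same_orbit T e s" using e(1) unfolding same_orbit_def
      by (simp flip: mult.assoc)
  qed (use that in \<open>auto simp: X_def\<close>)
  have fin: "finite X" by (simp add: X_def)
  have "coeff_sum (same_orbit T e) f = (\<Sum>s\<in>supp f. \<Sum>x\<in>X. if e * s = x then coeff f s else 0)"
    unfolding coeff_sum_def by (rule sum.cong) (use mem fin in simp_all)
  also have "\<dots> = (\<Sum>x\<in>X. coeff_sum (\<lambda>s. x * x\<^sup>\<star> * s = x) f)"
    unfolding coeff_sum_def by (subst sum.swap, intro sum.cong) (use range in simp_all)
  also have "\<dots> = (\<Sum>x\<in>X. if x = e then 1 else 0)"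
    by (intro sum.cong) (use range idem zero in simp_all)
  also have "\<dots> = 1" using fin by (simp add: X_def)
  finally show ?thesis .
qed

text \<open>Let \<open>f\<close> be a right unit for the elements \<open>g - g * g\<^sup>\<star>\<close> inside the left ideal of
  elements that vanish on all right \<open>T\<close>-orbits. The function \<open>h\<close> below is the value of \<open>1 - f\<close> on
  the groupoid of germs at principal filters: \<open>1 - f\<close> is left \<open>T\<close>-invariant, of finite support
  on each fibre, and nonzero on some element of each right orbit.\<close>

lemma locally_finite_if_regular:
  assumes reg: "von_neumann_regular TYPE(('s::inverse_semigroup, 'r::ring_1) semigroup_ring)"
  shows "locally_finite_semigroup TYPE('s)"
  unfolding locally_finite_semigroup_def
proof (intro allI impI)
  fix B :: "'s set" assume "finite B"
  define A where "A = B \<union> star ` B"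
  have A: "finite A" "\<And>a. a \<in> A \<Longrightarrow> a\<^sup>\<star> \<in> A"
    using \<open>finite B\<close> by (auto simp: A_def)
  define T where "T = generated_subsemigroup A"
  have T: "\<And>s t. s \<in> T \<Longrightarrow> t \<in> T \<Longrightarrow> s * t \<in> T" "\<And>t. t \<in> T \<Longrightarrow> t\<^sup>\<star> \<in> T" "A \<subseteq> T"
    using generated_subsemigroup_star[OF A(2)] by (auto simp: T_def intro: generated_subsemigroup.intros)
  \<comment> \<open>The ring may lack a unit, so the condition on \<open>a\<close> does not follow
    from the one on all \<open>r * a\<close>; both are imposed to get a left ideal.\<close>
  define J :: "('s, 'r) semigroup_ring set" where
    "J = {a. \<forall>e. coeff_sum (same_orbit T e) a = 0 \<and> (\<forall>r. coeff_sum (same_orbit T e) (r * a) = 0)}"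
  define d :: "'s \<Rightarrow> ('s, 'r) semigroup_ring" where "d g = atom g 1 - atom (g * g\<^sup>\<star>) 1" for g
  have "d g \<in> J" if "g \<in> A" for g
  proof -
    have g: "g \<in> T" "g\<^sup>\<star> \<in> T" using that T by auto
    have zero: "coeff_sum (same_orbit T e) (r * d g) = 0" for e r
      using same_orbit_mult[OF T(1) g, of e]
      by (simp add: d_def right_diff_distrib coeff_sum_diff coeff_sum_mult_atom)
    \<comment> \<open>Thus \<open>d g\<close> is itself of the form \<open>r * d g\<close>, and the
      condition without \<open>r\<close> follows.\<close>
    have "d g = atom (g * g\<^sup>\<star>) 1 * d g"
      by (simp add: d_def right_diff_distrib mult.assoc)
    then show ?thesis using zero zero[of _ "atom (g * g\<^sup>\<star>) 1"] by (simp add: J_def)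
  qed
  then have "\<exists>f\<in>J. \<forall>a\<in>d ` A. a * f = a"
    by (intro regular_common_right_unit[OF reg])
      (use A(1) in \<open>auto simp: J_def coeff_sum_add coeff_sum_diff algebra_simps
        simp flip: mult.assoc\<close>)
  then obtain f where fJ: "f \<in> J" and f: "\<And>g. g \<in> A \<Longrightarrow> d g * f = d g" by auto
  \<comment> \<open>The predicate says that \<open>y\<close> lies below \<open>s\<close> in the
    natural partial order; the formal 1 contributes exactly at idempotents.\<close>
  define h :: "'s \<Rightarrow> 'r" where
    "h y = (if y * y = y then 1 else 0) - coeff_sum (\<lambda>s. y * y\<^sup>\<star> * s = y) f" for y
  \<comment> \<open>This reads \<open>d g * f = d g\<close> at the germ \<open>y\<close>. Facts 1 to
    4 below translate the predicates for its four terms.\<close>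
  have step: "h (g\<^sup>\<star> * y) = h y" if g: "g \<in> A" and y: "g * (g\<^sup>\<star> * y) = y" for g y
  proof -
    have y': "g * (g\<^sup>\<star> * (y * x)) = y * x" for x
      using arg_cong[OF y, of "\<lambda>z. z * x"] by (simp add: mult.assoc)
    have ystar: "y\<^sup>\<star> * (g * g\<^sup>\<star>) = y\<^sup>\<star>"
      using arg_cong[OF y, of star] by (simp add: mult.assoc)
    have ystar': "y\<^sup>\<star> * (g * (g\<^sup>\<star> * x)) = y\<^sup>\<star> * x" for x
      using arg_cong[OF ystar, of "\<lambda>z. z * x"] by (simp add: mult.assoc)
    let ?P = "\<lambda>s. y * y\<^sup>\<star> * s = y"
    have 1: "?P (g * t) \<longleftrightarrow> (g\<^sup>\<star> * y) * (g\<^sup>\<star> * y)\<^sup>\<star> * t = g\<^sup>\<star> * y" for t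
    proof
      assume "?P (g * t)"
      from arg_cong[OF this, of "\<lambda>z. g\<^sup>\<star> * z"]
      show "(g\<^sup>\<star> * y) * (g\<^sup>\<star> * y)\<^sup>\<star> * t = g\<^sup>\<star> * y" by (simp add: mult.assoc)
    next
      assume "(g\<^sup>\<star> * y) * (g\<^sup>\<star> * y)\<^sup>\<star> * t = g\<^sup>\<star> * y"
      from arg_cong[OF this, of "\<lambda>z. g * z"]
      show "?P (g * t)" by (simp add: mult.assoc y y')
    qed
    have 2: "?P (g * (g\<^sup>\<star> * t)) \<longleftrightarrow> ?P t" for t
      by (simp add: mult.assoc ystar')
    have 3: "?P g \<longleftrightarrow> (g\<^sup>\<star> * y) * (g\<^sup>\<star> * y) = g\<^sup>\<star> * y"
    proof
      assume "?P g"
      then have "g\<^sup>\<star> * y = g\<^sup>\<star> * y * (g\<^sup>\<star> * y)\<^sup>\<star>" by (simp add: mult.assoc)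
      then show "(g\<^sup>\<star> * y) * (g\<^sup>\<star> * y) = g\<^sup>\<star> * y" by (metis idem_star_mult(2))
    next
      assume idem: "(g\<^sup>\<star> * y) * (g\<^sup>\<star> * y) = g\<^sup>\<star> * y"
      from star_idem[OF this] have k: "y\<^sup>\<star> * g = g\<^sup>\<star> * y" by simp
      have "y * y\<^sup>\<star> * g = g * ((g\<^sup>\<star> * y) * (g\<^sup>\<star> * y))"
        by (simp add: mult.assoc k y')
      also have "\<dots> = y" unfolding idem by (rule y)
      finally show "?P g" .
    qed
    have 4: "?P (g * g\<^sup>\<star>) \<longleftrightarrow> y * y = y"
    proof -
      have "?P (g * g\<^sup>\<star>) \<longleftrightarrow> y * y\<^sup>\<star> = y" by (simp add: mult.assoc ystar)
      also have "\<dots> \<longleftrightarrow> y * y = y" by (metis idem_star_mult(2) star_idem)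
      finally show ?thesis .
    qed
    have "coeff_sum ?P (d g * f) = coeff_sum ?P (d g)" using f[OF g] by simp
    then have "coeff_sum (\<lambda>t. ?P (g * t)) f - coeff_sum (\<lambda>t. ?P (g * (g\<^sup>\<star> * t))) f =
        (if ?P g then 1 else 0) - (if ?P (g * g\<^sup>\<star>) then 1 else 0)"
      by (simp add: d_def left_diff_distrib coeff_sum_diff coeff_sum_atom_mult mult.assoc)
    then have "coeff_sum (\<lambda>t. (g\<^sup>\<star> * y) * (g\<^sup>\<star> * y)\<^sup>\<star> * t = g\<^sup>\<star> * y) f - coeff_sum ?P f =
        (if (g\<^sup>\<star> * y) * (g\<^sup>\<star> * y) = g\<^sup>\<star> * y then 1 else 0) - (if y * y = y then 1 else 0)"
      unfolding 2 3 4 unfolding 1 .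
    moreover have "c - a = d - b" if "a - b = c - d" for a b c d :: 'r
      using that by (simp add: algebra_simps)
    ultimately show ?thesis
      unfolding h_def by blast
  qed
  have invariant: "h (t * x) = h x" if "t \<in> T" "defined_at t x" for t x
    using that unfolding T_def
  proof (induction arbitrary: x)
    case (generator g)
    then show ?case
      using step[of "g\<^sup>\<star>" x] A(2) by (simp add: defined_at_def mult.assoc)
  next
    case (mult s t)
    then show ?case by (simp add: defined_at_mult mult.assoc)
  qed
  let ?M = "card (supp f) + 1"
  have "finite (orbit T (t\<^sup>\<star> * t)) \<and> card (orbit T (t\<^sup>\<star> * t)) \<le> ?M" if t: "t \<in> T" for t
  proof -
    let ?e = "t\<^sup>\<star> * t"
    have e: "?e * ?e = ?e" "?e\<^sup>\<star> = ?e" "?e \<in> T" using t T by simp_all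
    then have "same_orbit T ?e ?e" unfolding same_orbit_def by (intro bexI[of _ ?e]) auto
    moreover have "coeff_sum (same_orbit T ?e) f = 0" using fJ by (simp add: J_def)
    \<comment> \<open>Were \<open>h\<close> zero at all these \<open>x\<close>,
      \<open>sum_coeff_fibre\<close> would give the value 1 to a sum that is 0 because
      \<open>f \<in> J\<close>.\<close>
    ultimately obtain x where x: "x * x\<^sup>\<star> = ?e" "h x \<noteq> 0"
      using sum_coeff_fibre[OF e(1), of T f] unfolding h_def by fastforce
    \<comment> \<open>Right multiplication by \<open>x\<close> embeds the orbit into
      \<open>?W\<close>: \<open>h\<close> is nonzero at each image \<open>z\<close>, so
      \<open>z\<close> is idempotent and equals \<open>x\<^sup>\<star> * x\<close>, or lies below
      some \<open>s\<close> in the support of \<open>f\<close> and is the restriction of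
      \<open>s\<close> to \<open>x\<^sup>\<star> * x\<close>.\<close>
    let ?W = "insert (x\<^sup>\<star> * x) ((\<lambda>s. s * (x\<^sup>\<star> * x)) ` supp f)"
    have ex: "?e * x = x" unfolding x(1)[symmetric] by (simp add: mult.assoc)
    have "(\<lambda>v. v * x) ` orbit T ?e \<subseteq> ?W"
    proof
      fix z assume "z \<in> (\<lambda>v. v * x) ` orbit T ?e"
      then obtain u where u: "u \<in> T" "defined_at u ?e" "z = u * ?e * x"
        unfolding orbit_def by auto
      then have z: "z = u * x" by (simp add: mult.assoc ex[unfolded mult.assoc])
      have dx: "u\<^sup>\<star> * (u * x) = x"
      proof -
        have "u\<^sup>\<star> * u * (?e * x) = ?e * x"
          using u(2) unfolding defined_at_def by (metis mult.assoc)
        then show ?thesis unfolding ex by (simp add: mult.assoc)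
      qed
      then have "h z \<noteq> 0"
        using invariant[OF u(1), of x] x(2) by (simp add: z defined_at_def mult.assoc)
      have zz: "z\<^sup>\<star> * z = x\<^sup>\<star> * x" by (simp add: z mult.assoc dx)
      show "z \<in> ?W"
      proof (cases "z * z = z")
        case True
        then show ?thesis using zz star_idem[OF True] by simp
      next
        case False
        then have "(\<Sum>s\<in>supp f. if z * z\<^sup>\<star> * s = z then coeff f s else 0) \<noteq> 0"
          using \<open>h z \<noteq> 0\<close> by (simp add: h_def coeff_sum_def)
        then obtain s where s: "s \<in> supp f" "(if z * z\<^sup>\<star> * s = z then coeff f s else 0) \<noteq> 0"
          by (rule sum.not_neutral_contains_not_neutral)
        then have zs: "z * (z\<^sup>\<star> * s) = z" by (auto simp: mult.assoc split: if_splits)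
        have zs': "s\<^sup>\<star> * (z * z\<^sup>\<star>) = z\<^sup>\<star>" using arg_cong[OF zs, of star] by (simp add: mult.assoc)
        have "s * (z\<^sup>\<star> * z) = s * (s\<^sup>\<star> * (z * (z\<^sup>\<star> * z)))"
          using arg_cong[OF zs', of "\<lambda>y. s * (y * z)"] by (simp add: mult.assoc)
        also have "\<dots> = s * (s\<^sup>\<star> * (z * (z\<^sup>\<star> * s)))" by (simp add: zs)
        also have "\<dots> = z * (z\<^sup>\<star> * (s * (s\<^sup>\<star> * s)))"
          using proj_commute(2)[of "s\<^sup>\<star>" z s] by simp
        also have "\<dots> = z" by (simp add: zs)
        finally show ?thesis using s(1) zz by auto
      qed
    qed
    moreover have inj: "inj_on (\<lambda>v. v * x) (orbit T ?e)"
    proof (rule inj_on_inverseI[of _ "\<lambda>z. z * x\<^sup>\<star>"])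
      fix v assume "v \<in> orbit T ?e"
      then obtain u where "v = u * ?e" unfolding orbit_def by auto
      then show "v * x * x\<^sup>\<star> = v" using x(1) e(1) by (simp add: mult.assoc)
    qed
    moreover have "finite ?W" by simp
    moreover have "card ?W \<le> ?M"
      using card_image_le[of "supp f" "\<lambda>s. s * (x\<^sup>\<star> * x)"]
      by (simp add: card_insert_if)
    ultimately show ?thesis
      by (metis (lifting) card_image card_mono finite_imageD finite_subset le_trans)
  qed
  then have "finite T"
    unfolding T_def by (intro finite_generated_subsemigroup_if_bounded_orbits A)
  moreover have "generated_subsemigroup B \<subseteq> T"
    unfolding T_def A_def by (rule generated_subsemigroup_mono) simp
  ultimately show "finite (generated_subsemigroup B)" by (rule finite_subset[rotated])
qed

subsection \<open>Regularity of matrix rings\<close>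

text \<open>The witness is the expansion of \<open>b + (1 - b * a) * c * (1 - a * b)\<close> with a
  formal 1, as \<open>a - a * b * a\<close> is both \<open>a * (1 - b * a)\<close> and
  \<open>(1 - a * b) * a\<close>.\<close>

lemma regular_if_difference_regular:
  fixes a :: "'a::ring"
  assumes "(a - a * b * a) * c * (a - a * b * a) = a - a * b * a"
  shows "\<exists>d. a * d * a = a"
proof
  have "a * (b + c - b * a * c - c * a * b + b * a * c * a * b) * a =
      a * b * a + (a - a * b * a) * c * (a - a * b * a)"
    by (simp add: algebra_simps)
  also have "\<dots> = a" unfolding assms by simp
  finally show "a * (b + c - b * a * c - c * a * b + b * a * c * a * b) * a = a" .
qed

definition mat_mult :: "'i set \<Rightarrow> ('i \<Rightarrow> 'i \<Rightarrow> 'r::ring) \<Rightarrow> ('i \<Rightarrow> 'i \<Rightarrow> 'r) \<Rightarrow> 'i \<Rightarrow> 'i \<Rightarrow> 'r" where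
  "mat_mult L A B = (\<lambda>x z. \<Sum>y\<in>L. A x y * B y z)"

lemma mat_mult_assoc: "mat_mult L (mat_mult L A B) C = mat_mult L A (mat_mult L B C)"
  unfolding mat_mult_def
  by (intro ext, simp only: sum_distrib_left sum_distrib_right mult.assoc) (rule sum.swap)

lemma mat_mult_distrib:
  "mat_mult L (A + B) C = mat_mult L A C + mat_mult L B C"
  "mat_mult L A (B + C) = mat_mult L A B + mat_mult L A C"
  "mat_mult L (A - B) C = mat_mult L A C - mat_mult L B C"
  "mat_mult L A (B - C) = mat_mult L A B - mat_mult L A C"
  unfolding mat_mult_def
  by (intro ext, simp add: algebra_simps sum.distrib sum_subtractf)+

text \<open>The same witness as in \<open>regular_if_difference_regular\<close>, repeated because
  matrices over a variable index set \<open>L\<close> are not a type of class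
  \<open>ring\<close>.\<close>

lemma matrix_regular_if_difference_regular:
  fixes L :: "'i set" and A :: "'i \<Rightarrow> 'i \<Rightarrow> 'r::ring"
  defines "m \<equiv> mat_mult L"
  assumes "m (m (A - m (m A X) A) C) (A - m (m A X) A) = A - m (m A X) A"
  shows "\<exists>Y. m (m A Y) A = A"
proof
  let ?Y = "X + C - m (m X A) C - m (m C A) X + m (m (m (m X A) C) A) X"
  have "m (m A ?Y) A = m (m A X) A + m (m (A - m (m A X) A) C) (A - m (m A X) A)"
    by (simp add: m_def mat_mult_distrib mat_mult_assoc algebra_simps)
  also have "\<dots> = A" unfolding assms(2) by simp
  finally show "m (m A ?Y) A = A" .
qed

text \<open>The nonzero entries are cleared one at a time, row by row: subtracting \<open>A * X * A\<close>, where
  \<open>X\<close> has a quasi-inverse of the entry at \<open>(i, j)\<close> as its only entry, clears that entry and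
  creates no nonzero entry at a cleared position.\<close>

lemma matrix_regular:
  fixes A :: "'i \<Rightarrow> 'i \<Rightarrow> 'r::ring"
  assumes reg: "von_neumann_regular TYPE('r)" and L: "finite L"
    and A: "\<And>x y. A x y \<noteq> 0 \<Longrightarrow> x \<in> L \<and> y \<in> L"
  shows "\<exists>X. mat_mult L (mat_mult L A X) A = A"
proof -
  let ?reg = "\<lambda>A. \<exists>X. mat_mult L (mat_mult L A X) A = A"
  \<comment> \<open>\<open>I\<close> contains the rows not yet cleared; in the inner induction
    \<open>J\<close> contains the columns not yet cleared in row \<open>i\<close>.\<close>
  have "\<forall>A::'i \<Rightarrow> 'i \<Rightarrow> 'r. (\<forall>x y. A x y \<noteq> 0 \<longrightarrow> x \<in> I \<and> y \<in> L) \<longrightarrow> ?reg A"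
    if "finite I" "I \<subseteq> L" for I
    using that
  proof induction
    case empty
    show ?case
    proof (intro allI impI)
      fix A :: "'i \<Rightarrow> 'i \<Rightarrow> 'r" assume "\<forall>x y. A x y \<noteq> 0 \<longrightarrow> x \<in> {} \<and> y \<in> L"
      then have zero: "A x y = 0" for x y by blast
      have "mat_mult L (mat_mult L A A) A = A"
        by (intro ext) (simp add: mat_mult_def zero)
      then show "?reg A" by blast
    qed
  next
    case (insert i I)
    have "\<forall>A::'i \<Rightarrow> 'i \<Rightarrow> 'r. (\<forall>x y. A x y \<noteq> 0 \<longrightarrow> x \<in> insert i I \<and> y \<in> L \<and> (x = i \<longrightarrow> y \<in> J)) \<longrightarrow> ?reg A"
      if "finite J" "J \<subseteq> L" for J
      using that
    proof induction
      case empty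
      show ?case
      proof (intro allI impI)
        fix A :: "'i \<Rightarrow> 'i \<Rightarrow> 'r"
        assume A: "\<forall>x y. A x y \<noteq> 0 \<longrightarrow> x \<in> insert i I \<and> y \<in> L \<and> (x = i \<longrightarrow> y \<in> {})"
        then have "\<forall>x y. A x y \<noteq> 0 \<longrightarrow> x \<in> I \<and> y \<in> L" by blast
        moreover have "I \<subseteq> L" using insert.prems by simp
        ultimately show "?reg A" using insert.IH by blast
      qed
    next
      case (insert j J)
      show ?case
      proof (intro allI impI)
        fix A :: "'i \<Rightarrow> 'i \<Rightarrow> 'r"
        assume A: "\<forall>x y. A x y \<noteq> 0 \<longrightarrow> x \<in> Set.insert i I \<and> y \<in> L \<and> (x = i \<longrightarrow> y \<in> Set.insert j J)"
        obtain x where x: "A i j * x * A i j = A i j"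
          using reg unfolding von_neumann_regular_def by blast
        define X where "X p q = (if p = j \<and> q = i then x else 0)" for p q
        have ij: "i \<in> L" "j \<in> L" using insert.prems \<open>Set.insert i I \<subseteq> L\<close> by auto
        have X1: "mat_mult L A X k q = (if q = i then A k j * x else 0)" for k q
          unfolding mat_mult_def X_def using ij(2) L
          by (cases "q = i") (simp_all add: if_distrib[of "\<lambda>z. _ * z"] cong: if_cong)
        \<comment> \<open>Zero rows and columns of \<open>A\<close> are zero here too. In row
          \<open>i\<close> the product agrees with \<open>A\<close> at column \<open>j\<close> and
          is zero wherever \<open>A\<close> is.\<close>
        have X2: "mat_mult L (mat_mult L A X) A k l = A k j * x * A i l" for k l
          unfolding mat_mult_def[of L "mat_mult L A X"] X1 using ij(1) L
          by (simp add: if_distrib[of "\<lambda>z. z * _"] cong: if_cong)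
        have "?reg (A - mat_mult L (mat_mult L A X) A)"
        proof (rule insert.IH[rule_format])
          show "J \<subseteq> L" using insert.prems by simp
          fix k l assume nz: "(A - mat_mult L (mat_mult L A X) A) k l \<noteq> 0"
          then have nz': "A k l - A k j * x * A i l \<noteq> 0" by (simp add: X2)
          show "k \<in> Set.insert i I \<and> l \<in> L \<and> (k = i \<longrightarrow> l \<in> J)"
          proof (intro conjI impI)
            show "k \<in> Set.insert i I" using nz' A by (metis diff_zero mult_zero_left)
            show "l \<in> L" using nz' A by (metis diff_zero mult_zero_right)
            assume k: "k = i"
            show "l \<in> J"
            proof (rule ccontr)
              assume "l \<notin> J"
              then have "l = j \<or> A i l = 0" using A by auto
              then show False using nz' k x by auto
            qed
          qed
        qed
        then show "?reg A" using matrix_regular_if_difference_regular by blast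
      qed
    qed
    from this[OF L order.refl] show ?case by (metis (no_types, lifting))
  qed
  from this[OF L] A show ?thesis by blast
qed

subsection \<open>Ideals of finite inverse semigroups\<close>

text \<open>The empty set counts as an ideal and is the base of the later induction.\<close>

definition ideal_in :: "'s::semigroup_mult set \<Rightarrow> 's set \<Rightarrow> bool" where
  "ideal_in T I \<longleftrightarrow> I \<subseteq> T \<and> (\<forall>s\<in>I. \<forall>t\<in>T. s * t \<in> I \<and> t * s \<in> I)"

text \<open>The fibre at \<open>e\<close> is the \<open>\<R>\<close>-class of the idempotent \<open>e\<close> in \<open>T\<close>.\<close>

definition fibre :: "'s::inverse_semigroup set \<Rightarrow> 's \<Rightarrow> 's set" where
  "fibre T e = {x \<in> T. x * x\<^sup>\<star> = e}"

text \<open>The form \<open>x\<^sup>\<star> * y\<close> labels elements by matrix positions;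
  \<open>(x, y)\<close> and \<open>(g * x, g * y)\<close> with \<open>g\<close> in the group at
  \<open>e\<close> label the same element.\<close>

definition D_class :: "'s::inverse_semigroup set \<Rightarrow> 's \<Rightarrow> 's set" where
  "D_class T e = {x\<^sup>\<star> * y |x y. x \<in> fibre T e \<and> y \<in> fibre T e}"

locale finite_inverse_subsemigroup =
  fixes T :: "'s::inverse_semigroup set"
  assumes finite_T: "finite T"
    and mult_T: "s \<in> T \<Longrightarrow> t \<in> T \<Longrightarrow> s * t \<in> T"
    and star_T: "s \<in> T \<Longrightarrow> s\<^sup>\<star> \<in> T"
begin

lemma fibre_simps:
  assumes "x \<in> fibre T e"
  shows "e * x = x" "e * (x * r) = x * r" "x\<^sup>\<star> * e = x\<^sup>\<star>" "x\<^sup>\<star> * (e * r) = x\<^sup>\<star> * r"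
    "x * x\<^sup>\<star> = e" "x * (x\<^sup>\<star> * r) = e * r" "x \<in> T"
  using assms by (auto simp: fibre_def mult.assoc)

lemma D_class_iff:
  "s \<in> D_class T e \<longleftrightarrow> s \<in> T \<and> (\<exists>x\<in>fibre T e. x\<^sup>\<star> * x = s * s\<^sup>\<star>)"
proof
  assume "s \<in> D_class T e"
  then obtain x y where xy: "x \<in> fibre T e" "y \<in> fibre T e" "s = x\<^sup>\<star> * y"
    unfolding D_class_def by auto
  then show "s \<in> T \<and> (\<exists>x\<in>fibre T e. x\<^sup>\<star> * x = s * s\<^sup>\<star>)"
    by (auto simp: mult_T star_T mult.assoc fibre_simps intro!: bexI[of _ x])
next
  assume "s \<in> T \<and> (\<exists>x\<in>fibre T e. x\<^sup>\<star> * x = s * s\<^sup>\<star>)"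
  then obtain x where x: "s \<in> T" "x \<in> fibre T e" "x\<^sup>\<star> * x = s * s\<^sup>\<star>" by auto
  have "x * s * (x * s)\<^sup>\<star> = x * (s * s\<^sup>\<star>) * x\<^sup>\<star>" by (simp add: mult.assoc)
  also have "\<dots> = e" unfolding x(3)[symmetric] using x(2) by (simp add: mult.assoc fibre_def)
  finally have "x * s \<in> fibre T e" using x by (simp add: fibre_def mult_T)
  moreover have "s = x\<^sup>\<star> * (x * s)"
    using arg_cong[OF x(3), of "\<lambda>z. z * s"] by (simp add: mult.assoc)
  ultimately show "s \<in> D_class T e" unfolding D_class_def using x(2) by blast
qed

lemma D_class_star: "s \<in> D_class T e \<Longrightarrow> s\<^sup>\<star> \<in> D_class T e"
  unfolding D_class_def by force

text \<open>The idempotent \<open>e\<close> is chosen in \<open>I\<close> so that the right ideal \<open>e * T\<close> is as large as possible.\<close>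

lemma ideal_maximal_D_class:
  assumes I: "ideal_in T I" "I \<noteq> {}"
  obtains e where "e * e = e" "e \<in> T" "e \<in> D_class T e" "D_class T e \<subseteq> I"
    "ideal_in T (I - D_class T e)"
    "\<And>s t. s \<in> D_class T e \<Longrightarrow> t \<in> T \<Longrightarrow> s * t \<in> D_class T e \<Longrightarrow> s * (t * t\<^sup>\<star>) = s"
proof -
  \<comment> \<open>The size of the right ideal \<open>s * T\<close>; it cannot grow when
    \<open>s\<close> is multiplied on either side.\<close>
  define \<rho> where "\<rho> s = card ((\<lambda>t. s * t) ` T)" for s
  have sub: "(\<lambda>u. s * t * u) ` T \<subseteq> (\<lambda>u. s * u) ` T" if "t \<in> T" for s t
    using that mult_T by (auto simp: mult.assoc)
  have \<rho>_right: "\<rho> (s * t) \<le> \<rho> s" if "t \<in> T" for s t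
    unfolding \<rho>_def using sub[OF that] finite_T by (intro card_mono) auto
  have \<rho>_left: "\<rho> (t * s) \<le> \<rho> s" for s t
  proof -
    have "(\<lambda>u. t * s * u) ` T = (\<lambda>v. t * v) ` (\<lambda>u. s * u) ` T"
      by (simp add: image_image mult.assoc)
    then show ?thesis unfolding \<rho>_def using finite_T by (simp add: card_image_le)
  qed
  have Imult: "s * t \<in> I" "t * s \<in> I" if "s \<in> I" "t \<in> T" for s t
    using I(1) that unfolding ideal_in_def by auto
  have IT: "s \<in> T" if "s \<in> I" for s using I(1) that unfolding ideal_in_def by auto
  have Istar: "s\<^sup>\<star> \<in> I" if "s \<in> I" for s
    using Imult(1)[OF Imult(2)[OF that, of "s\<^sup>\<star>"], of "s\<^sup>\<star>"] star_T[OF IT[OF that]]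
    by (simp add: mult.assoc)
  have "finite I" using I(1) finite_T finite_subset unfolding ideal_in_def by blast
  then have "Max (\<rho> ` I) \<in> \<rho> ` I" using I(2) by (intro Max_in) auto
  then obtain s0 where s0: "s0 \<in> I" "\<rho> s0 = Max (\<rho> ` I)" by auto
  have max: "\<rho> s \<le> \<rho> s0" if "s \<in> I" for s
    using that s0 \<open>finite I\<close> by simp
  define e where "e = s0 * s0\<^sup>\<star>"
  have e: "e * e = e" "e\<^sup>\<star> = e" "e \<in> I"
    using s0(1) Imult IT star_T by (simp_all add: e_def)
  have "e * s0 = s0" by (simp add: e_def mult.assoc)
  then have \<rho>e: "\<rho> s0 \<le> \<rho> e" using \<rho>_right[of s0 e] s0(1) IT by simp
  let ?L = "fibre T e" and ?D = "D_class T e"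
  have L: "x \<in> I" "\<rho> s0 \<le> \<rho> x" if "x \<in> ?L" for x
  proof -
    note x = fibre_simps[OF that]
    show "x \<in> I" using Imult(1)[OF e(3) x(7)] x(1) by simp
    show "\<rho> s0 \<le> \<rho> x" using \<rho>_right[OF star_T[OF x(7)], of x] x(5) \<rho>e by simp
  qed
  have D: "s \<in> I" "\<rho> s0 \<le> \<rho> s" if "s \<in> ?D" for s
  proof -
    from that obtain x y where xy: "x \<in> ?L" "y \<in> ?L" "s = x\<^sup>\<star> * y" unfolding D_class_def by auto
    show "s \<in> I" using xy L Imult star_T IT by auto
    have "x * s = y" using xy by (simp add: fibre_simps)
    then show "\<rho> s0 \<le> \<rho> s" using \<rho>_left[of x s] L(2)[OF xy(2)] by simp
  qed
  \<comment> \<open>Since \<open>\<rho>\<close> is maximal on the D-class, \<open>s * t\<close> and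
    \<open>s\<close> have equal right ideals. Hence \<open>s = s * t * u\<close> for some
    \<open>u\<close>, and the range projection of \<open>t\<close> fixes \<open>s\<close>.\<close>
  have key: "s * (t * t\<^sup>\<star>) = s" if s: "s \<in> I" and t: "t \<in> T" and st: "s * t \<in> ?D" for s t
  proof -
    have "\<rho> (s * t) = \<rho> s"
      using D(2)[OF st] max[OF s] \<rho>_right[OF t, of s] by simp
    then have "(\<lambda>u. s * t * u) ` T = (\<lambda>u. s * u) ` T"
      unfolding \<rho>_def using sub[OF t] finite_T by (intro card_subset_eq) auto
    moreover have "s \<in> (\<lambda>u. s * u) ` T"
      by (rule image_eqI[of _ _ "s\<^sup>\<star> * s"]) (use s IT mult_T star_T in auto)
    ultimately have "s \<in> (\<lambda>u. s * t * u) ` T" by blast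
    then obtain u where "s = s * t * u" by blast
    then have u: "s * (t * u) = s" by (simp add: mult.assoc)
    have "s * (t * t\<^sup>\<star>) = s * (s\<^sup>\<star> * (s * (t * t\<^sup>\<star>)))" by simp
    also have "\<dots> = s * (t * (t\<^sup>\<star> * (s\<^sup>\<star> * (s * (t * u)))))" by (simp only: proj_commute u)
    also have "\<dots> = s * (s\<^sup>\<star> * (s * (t * (t\<^sup>\<star> * (t * u)))))" by (simp only: proj_commute)
    also have "\<dots> = s" using u by simp
    finally show ?thesis .
  qed
  have right: "s \<in> ?D" if s: "s \<in> I" and t: "t \<in> T" and st: "s * t \<in> ?D" for s t
  proof -
    have "s * t * (s * t)\<^sup>\<star> = s * (t * t\<^sup>\<star>) * s\<^sup>\<star>" by (simp add: mult.assoc)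
    also have "\<dots> = s * s\<^sup>\<star>" unfolding key[OF that] ..
    finally show ?thesis using st s IT unfolding D_class_iff by auto
  qed
  have left: "s \<in> ?D" if s: "s \<in> I" and t: "t \<in> T" and ts: "t * s \<in> ?D" for s t
    using right[OF Istar[OF s] star_T[OF t]] D_class_star[OF ts] D_class_star[of "s\<^sup>\<star>" e] by simp
  show ?thesis
  proof (rule that)
    show "e * e = e" "e \<in> T" using e IT by auto
    then show "e \<in> ?D" unfolding D_class_iff fibre_def by (auto simp: e(2) intro!: exI[of _ e])
    show "?D \<subseteq> I" using D by auto
    show "ideal_in T (I - ?D)"
      unfolding ideal_in_def using IT Imult left right by blast
    show "s * (t * t\<^sup>\<star>) = s" if "s \<in> ?D" "t \<in> T" "s * t \<in> ?D" for s t
      using key that D by blast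
  qed
qed

end

section \<open>Triple products, maximal subgroups and invariant matrices\<close>

text \<open>A common bound \<open>F\<close> for the supports makes the index set depend only on
  \<open>F\<close> and \<open>s\<close>, ready to be reindexed by pairs of matrix indices.\<close>

lemma coeff_mult_mult:
  fixes a b c :: "('s::semigroup_mult, 'r::ring) semigroup_ring"
  assumes F: "finite F" "supp a \<subseteq> F" "supp b \<subseteq> F" "supp c \<subseteq> F"
  shows "coeff (a * b * c) s =
    (\<Sum>(p, q, t) \<in> {(p, q, t) \<in> F \<times> F \<times> F. p * q * t = s}. coeff a p * coeff b q * coeff c t)"
proof -
  have expand: "coeff_sum P (x * y) = (\<Sum>p\<in>F. coeff x p * coeff_sum (\<lambda>t. P (p * t)) y)"
    if "supp x \<subseteq> F" for P and x y :: "('s, 'r) semigroup_ring"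
    unfolding coeff_sum_mult using F(1) that
    by (intro sum.mono_neutral_left) (auto simp: in_keys_iff)
  have "coeff (a * b * c) s = coeff_sum (\<lambda>t. t = s) (a * (b * c))"
    by (simp add: coeff_sum_eq mult.assoc)
  also have "\<dots> = (\<Sum>p\<in>F. \<Sum>q\<in>F. \<Sum>t\<in>F. if p * q * t = s then coeff a p * coeff b q * coeff c t else 0)"
    by (simp add: expand F sum_distrib_left coeff_sum_superset[OF F(1,4)] mult.assoc
        if_distrib[of "\<lambda>z. _ * z"] cong: if_cong)
  also have "\<dots> = (\<Sum>(p, q, t) \<in> F \<times> F \<times> F. if p * q * t = s then coeff a p * coeff b q * coeff c t else 0)"
    by (simp add: sum.cartesian_product)
  also have "\<dots> = (\<Sum>(p, q, t) \<in> {(p, q, t) \<in> F \<times> F \<times> F. p * q * t = s}. coeff a p * coeff b q * coeff c t)"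
    using F(1) by (intro sum.mono_neutral_cong_right) (auto split: if_splits)
  finally show ?thesis .
qed

context finite_inverse_subsemigroup
begin

text \<open>For an idempotent \<open>e\<close> of \<open>T\<close> this is the maximal subgroup of
  \<open>T\<close> with identity \<open>e\<close>.\<close>

definition H_class :: "'s \<Rightarrow> 's set" where
  "H_class e = {g \<in> T. g * g\<^sup>\<star> = e \<and> g\<^sup>\<star> * g = e}"

lemma H_class_fibre: "g \<in> H_class e \<Longrightarrow> g \<in> fibre T e"
  by (auto simp: H_class_def fibre_def)

lemma H_class_simps:
  assumes "g \<in> H_class e"
  shows "g\<^sup>\<star> * g = e" "g\<^sup>\<star> * (g * r) = e * r" "g * e = g" "g * (e * r) = g * r"
proof -
  show 1: "g\<^sup>\<star> * g = e" using assms by (simp add: H_class_def)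
  then show "g\<^sup>\<star> * (g * r) = e * r" "g * e = g" "g * (e * r) = g * r"
    by (auto simp flip: mult.assoc) (auto simp: mult.assoc)
qed

lemma H_class_star: "g \<in> H_class e \<Longrightarrow> g\<^sup>\<star> \<in> H_class e"
  by (auto simp: H_class_def star_T)

lemma H_class_mult_fibre:
  assumes "g \<in> H_class e" "y \<in> fibre T e"
  shows "g * y \<in> fibre T e"
  using assms H_class_fibre[OF assms(1)]
  by (auto simp: fibre_def mult.assoc mult_T H_class_simps fibre_simps[OF assms(2)])

lemma subgroup_H_class:
  assumes "e * e = e" "e \<in> T"
  shows "subgroup_of_semigroup (H_class e)"
  unfolding subgroup_of_semigroup_def
proof (intro exI groupI)
  let ?G = "\<lparr>carrier = H_class e, monoid.mult = (*), one = e\<rparr>"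
  show "\<one>\<^bsub>?G\<^esub> \<in> carrier ?G"
    using assms star_idem[OF assms(1)] by (simp add: H_class_def)
  show "g \<otimes>\<^bsub>?G\<^esub> h \<in> carrier ?G" if "g \<in> carrier ?G" "h \<in> carrier ?G" for g h
  proof -
    have gh: "g \<in> H_class e" "h \<in> H_class e" using that by simp_all
    have "g * h \<in> fibre T e" using H_class_mult_fibre gh H_class_fibre by blast
    moreover have "(g * h)\<^sup>\<star> * (g * h) = e"
      using gh by (simp add: mult.assoc H_class_simps fibre_simps[OF H_class_fibre])
    ultimately show ?thesis by (simp add: H_class_def fibre_def)
  qed
  show "\<one>\<^bsub>?G\<^esub> \<otimes>\<^bsub>?G\<^esub> g = g" if "g \<in> carrier ?G" for g
    using that by (simp add: fibre_simps[OF H_class_fibre])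
  show "\<exists>h\<in>carrier ?G. h \<otimes>\<^bsub>?G\<^esub> g = \<one>\<^bsub>?G\<^esub>" if "g \<in> carrier ?G" for g
    using that by (intro bexI[of _ "g\<^sup>\<star>"]) (simp_all add: H_class_star H_class_simps)
qed (simp add: mult.assoc)

text \<open>These sets are the orbits of \<open>H_class e\<close> on the fibre, and the action is
  free: \<open>v * y\<^sup>\<star>\<close> recovers \<open>g\<close> from
  \<open>v = g * y\<close>.\<close>

lemma bij_betw_H_class_fibre:
  assumes y: "y \<in> fibre T e"
  shows "bij_betw (\<lambda>g. g * y) (H_class e) {v \<in> fibre T e. v\<^sup>\<star> * v = y\<^sup>\<star> * y}"
proof (rule bij_betw_byWitness[where f' = "\<lambda>v. v * y\<^sup>\<star>"])
  note y' = fibre_simps[OF y]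
  show "\<forall>g\<in>H_class e. g * y * y\<^sup>\<star> = g"
    by (simp add: mult.assoc y' H_class_simps)
  show "\<forall>v\<in>{v \<in> fibre T e. v\<^sup>\<star> * v = y\<^sup>\<star> * y}. v * y\<^sup>\<star> * y = v"
  proof clarify
    fix v assume v: "v\<^sup>\<star> * v = y\<^sup>\<star> * y"
    show "v * y\<^sup>\<star> * y = v" unfolding mult.assoc v[symmetric] by simp
  qed
  show "(\<lambda>g. g * y) ` H_class e \<subseteq> {v \<in> fibre T e. v\<^sup>\<star> * v = y\<^sup>\<star> * y}"
    using H_class_mult_fibre[OF _ y] by (auto simp: mult.assoc H_class_simps y')
  show "(\<lambda>v. v * y\<^sup>\<star>) ` {v \<in> fibre T e. v\<^sup>\<star> * v = y\<^sup>\<star> * y} \<subseteq> H_class e"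
  proof clarify
    fix v assume v: "v \<in> fibre T e" "v\<^sup>\<star> * v = y\<^sup>\<star> * y"
    note v' = fibre_simps[OF v(1)]
    have "v * y\<^sup>\<star> * (v * y\<^sup>\<star>)\<^sup>\<star> = v * (v\<^sup>\<star> * v) * v\<^sup>\<star>" unfolding v(2) by (simp add: mult.assoc)
    moreover have "(v * y\<^sup>\<star>)\<^sup>\<star> * (v * y\<^sup>\<star>) = y * (v\<^sup>\<star> * v) * y\<^sup>\<star>" by (simp add: mult.assoc)
    then have "(v * y\<^sup>\<star>)\<^sup>\<star> * (v * y\<^sup>\<star>) = y * (y\<^sup>\<star> * y) * y\<^sup>\<star>" unfolding v(2) .
    ultimately show "v * y\<^sup>\<star> \<in> H_class e"
      using v'(5,7) y'(5,7) mult_T star_T by (simp add: H_class_def mult.assoc)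
  qed
qed

lemma bij_betw_H_class_translation:
  assumes g: "g \<in> H_class e"
  shows "bij_betw (\<lambda>y. g * y) (fibre T e) (fibre T e)"
proof (rule bij_betw_byWitness[where f' = "\<lambda>y. g\<^sup>\<star> * y"])
  show "\<forall>y\<in>fibre T e. g\<^sup>\<star> * (g * y) = y"
    using g by (simp add: H_class_simps fibre_simps)
  show "\<forall>y\<in>fibre T e. g * (g\<^sup>\<star> * y) = y"
    using H_class_simps(2)[OF H_class_star[OF g]] by (simp add: fibre_simps)
qed (use H_class_mult_fibre H_class_star g in auto)

text \<open>Modulo the ideal \<open>I - D_class T e\<close>, the ring of elements supported in \<open>D_class T e\<close> is the ring
  of matrices over \<open>fibre T e\<close> that are invariant under left translation by the group
  \<open>H_class e\<close>. A quasi-inverse in the full matrix ring becomes an invariant one by averaging.\<close>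

lemma quasi_inverse_modulo_ideal:
  fixes a :: "('s, 'r::ring_1) semigroup_ring"
  assumes reg: "von_neumann_regular TYPE('r)"
    and e: "e * e = e" "e \<in> T" and D: "D_class T e \<subseteq> I"
    and I: "ideal_in T I" "ideal_in T (I - D_class T e)"
    and comp: "\<And>s t. s \<in> D_class T e \<Longrightarrow> t \<in> T \<Longrightarrow> s * t \<in> D_class T e \<Longrightarrow> s * (t * t\<^sup>\<star>) = s"
    and u: "of_nat (card (H_class e)) * u = (1::'r)" "u * of_nat (card (H_class e)) = 1"
    and a: "supp a \<subseteq> I"
  shows "\<exists>b. supp (a - a * b * a) \<subseteq> I - D_class T e"
proof -
  let ?L = "fibre T e" and ?D = "D_class T e" and ?G = "H_class e"
  have IT: "I \<subseteq> T" using I(1) by (simp add: ideal_in_def)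
  have fin: "finite I" "finite ?L" "finite ?D" "finite ?G"
    using finite_subset[OF _ finite_T] IT D
    by (auto simp: fibre_def H_class_def)
  have L_D: "x\<^sup>\<star> * y \<in> ?D" if "x \<in> ?L" "y \<in> ?L" for x y
    using that by (auto simp: D_class_def)
  \<comment> \<open>The inverse of a central element is central.\<close>
  have central: "u * r = r * u" for r :: 'r
  proof -
    have "u * r = u * r * (of_nat (card ?G) * u)" using u by simp
    also have "\<dots> = u * (of_nat (card ?G) * r) * u" by (simp add: mult.assoc mult_of_nat_commute)
    also have "\<dots> = r * u" by (simp add: u flip: mult.assoc)
    finally show ?thesis .
  qed

  \<comment> \<open>The matrix of \<open>a\<close> modulo the smaller ideal; the default 0 off the
    fibre is the support condition of \<open>matrix_regular\<close>.\<close>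
  define A where "A x y = (if x \<in> ?L \<and> y \<in> ?L then coeff a (x\<^sup>\<star> * y) else 0)" for x y
  have "\<exists>X. mat_mult ?L (mat_mult ?L A X) A = A"
    by (rule matrix_regular[OF reg fin(2)]) (simp add: A_def split: if_splits)
  then obtain X where X: "mat_mult ?L (mat_mult ?L A X) A = A" ..
  \<comment> \<open>For \<open>s\<close> in the D-class, the pairs \<open>(x, x * s)\<close> are all
    the positions labelled by \<open>s\<close>, and \<open>u\<close> inverts their number: an
    average without a choice of representative.\<close>
  define \<beta> where "\<beta> s = u * (\<Sum>x\<in>{x\<in>?L. x\<^sup>\<star> * x = s * s\<^sup>\<star>}. X x (x * s))" for s
  define b where "b = (\<Sum>s\<in>?D. atom s (\<beta> s))"
  have b: "coeff b s = (if s \<in> ?D then \<beta> s else 0)" for s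
  proof -
    have "coeff b s = coeff_sum (\<lambda>t. t = s) (\<Sum>s\<in>?D. atom s (\<beta> s))"
      by (simp add: b_def coeff_sum_eq)
    also have "\<dots> = (if s \<in> ?D then \<beta> s else 0)"
      using fin(3) by (simp add: coeff_sum_sum)
    finally show ?thesis .
  qed
  then have supp_b: "supp b \<subseteq> I" using D by (auto simp: in_keys_iff split: if_splits)

  have average: "\<beta> (y\<^sup>\<star> * z) = u * (\<Sum>g\<in>?G. X (g * y) (g * z))" if "y \<in> ?L" "z \<in> ?L" for y z
  proof -
    note y = fibre_simps[OF that(1)] and z = fibre_simps[OF that(2)]
    have "(\<Sum>g\<in>?G. X (g * y) (g * y * (y\<^sup>\<star> * z))) =
        (\<Sum>x\<in>{x\<in>?L. x\<^sup>\<star> * x = y\<^sup>\<star> * y}. X x (x * (y\<^sup>\<star> * z)))"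
      by (rule sum.reindex_bij_betw[OF bij_betw_H_class_fibre[OF that(1)]])
    then show ?thesis
      unfolding \<beta>_def by (simp add: mult.assoc y z H_class_simps cong: sum.cong)
  qed
  have invariant: "A (g * x) (g * y) = A x y" if "g \<in> ?G" "x \<in> ?L" "y \<in> ?L" for g x y
    using that H_class_mult_fibre by (simp add: A_def mult.assoc H_class_simps fibre_simps)

  have coeff_D: "coeff (a * b * a) s = coeff a s" if s: "s \<in> ?D" for s
  proof -
    obtain x where x: "x \<in> ?L" "x\<^sup>\<star> * x = s * s\<^sup>\<star>" using s D_class_iff by blast
    define w where "w = x * s"
    have xw: "x\<^sup>\<star> * w = s"
      unfolding w_def mult.assoc[symmetric] x(2) by (simp add: mult.assoc)
    have "w * w\<^sup>\<star> = x * (x\<^sup>\<star> * x) * x\<^sup>\<star>" unfolding w_def x(2) by (simp add: mult.assoc)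
    then have w: "w \<in> ?L"
      using x(1) s D IT mult_T by (auto simp: fibre_def w_def mult.assoc)
    let ?S = "{(p, q, t) \<in> I \<times> I \<times> I. p * q * t = s}"
    let ?f = "\<lambda>(y, z). (x\<^sup>\<star> * y, y\<^sup>\<star> * z, z\<^sup>\<star> * w)"
    \<comment> \<open>Factorizations of \<open>s = x\<^sup>\<star> * w\<close> inside
      \<open>I\<close> correspond to paths \<open>x\<close>, \<open>y\<close>, \<open>z\<close>,
      \<open>w\<close>, like the terms of a matrix product.\<close>
    have bij: "bij_betw ?f (?L \<times> ?L) ?S"
    proof (rule bij_betw_byWitness[where f' = "\<lambda>(p, q, t). (x * p, x * p * q)"])
      show "\<forall>yz\<in>?L \<times> ?L. (case ?f yz of (p, q, t) \<Rightarrow> (x * p, x * p * q)) = yz"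
        using x by (auto simp: mult.assoc fibre_simps)
      show "?f ` (?L \<times> ?L) \<subseteq> ?S"
      proof clarify
        fix y z assume yz: "y \<in> ?L" "z \<in> ?L"
        then have "x\<^sup>\<star> * y \<in> I" "y\<^sup>\<star> * z \<in> I" "z\<^sup>\<star> * w \<in> I" using L_D x w D by blast+
        moreover have "x\<^sup>\<star> * y * (y\<^sup>\<star> * z) * (z\<^sup>\<star> * w) = s"
          using yz x w by (simp add: mult.assoc fibre_simps xw)
        ultimately show "(x\<^sup>\<star> * y, y\<^sup>\<star> * z, z\<^sup>\<star> * w) \<in> I \<times> I \<times> I \<and> x\<^sup>\<star> * y * (y\<^sup>\<star> * z) * (z\<^sup>\<star> * w) = s"
          by simp
      qed
      have inverse: "x * p \<in> ?L \<and> x * p * q \<in> ?L \<and> x\<^sup>\<star> * (x * p) = p \<and>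
          (x * p)\<^sup>\<star> * (x * p * q) = q \<and> (x * p * q)\<^sup>\<star> * w = t"
        if pqt: "p \<in> I" "q \<in> I" "t \<in> I" "p * q * t = s" for p q t
      proof -
        have I': "r * r' \<in> I - ?D" "r' * r \<in> I - ?D" if "r \<in> I - ?D" "r' \<in> T" for r r'
          using I(2) that unfolding ideal_in_def by blast+
        have T: "p \<in> T" "q \<in> T" "t \<in> T" "q * t \<in> T" using pqt IT mult_T by auto
        have II: "p * q \<in> I" "q * t \<in> I"
          using I(1) pqt T unfolding ideal_in_def by auto
        \<comment> \<open>As \<open>I - D_class T e\<close> is an ideal, a factor or partial product
          outside the D-class would force \<open>s\<close> outside it.\<close>
        have pqD: "p * q \<in> ?D"
        proof (rule ccontr)
          assume "p * q \<notin> ?D"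
          then have "p * q * t \<in> I - ?D" using I' II T by blast
          then show False using pqt s by blast
        qed
        have pD: "p \<in> ?D" using I'(1)[of p q] pqt T pqD by blast
        have qtD: "q * t \<in> ?D"
        proof (rule ccontr)
          assume "q * t \<notin> ?D"
          then have "p * (q * t) \<in> I - ?D" using I' II T by blast
          then show False using pqt s by (simp add: mult.assoc)
        qed
        have qD: "q \<in> ?D" using I'(1)[of q t] pqt T qtD by blast
        have tD: "t \<in> ?D" using I'(2)[of t q] pqt T qtD by blast
        \<comment> \<open>\<open>comp\<close> and its mirror image under inversion bound each of the
          two projections by the other.\<close>
        have match: "r\<^sup>\<star> * r = r' * r'\<^sup>\<star>" if "r \<in> ?D" "r' \<in> ?D" "r * r' \<in> ?D" for r r'
        proof -
          have rT: "r \<in> T" "r' \<in> T" using that D IT by auto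
          have 1: "r * (r' * r'\<^sup>\<star>) = r" using comp that rT by blast
          have "r'\<^sup>\<star> * r\<^sup>\<star> \<in> ?D" using D_class_star[OF that(3)] by simp
          then have 2: "r'\<^sup>\<star> * (r\<^sup>\<star> * r) = r'\<^sup>\<star>"
            using comp[of "r'\<^sup>\<star>" "r\<^sup>\<star>"] that D_class_star star_T rT by simp
          have "r\<^sup>\<star> * r = r\<^sup>\<star> * (r * (r' * r'\<^sup>\<star>))" using 1 by simp
          also have "\<dots> = r' * r'\<^sup>\<star>" using 2 by (simp add: proj_commute)
          finally show ?thesis .
        qed
        have pq: "p\<^sup>\<star> * p = q * q\<^sup>\<star>" and qt: "q\<^sup>\<star> * q = t * t\<^sup>\<star>"
          using match pD qD tD pqD qtD by auto
        have k: "p * (q * t * (q * t)\<^sup>\<star>) = p"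
          using comp[OF pD T(4)] pqt(4) s by (simp add: mult.assoc)
        have "s * s\<^sup>\<star> = p * (q * t * (q * t)\<^sup>\<star>) * p\<^sup>\<star>"
          by (simp add: mult.assoc flip: pqt(4))
        then have "s * s\<^sup>\<star> = p * p\<^sup>\<star>" unfolding k .
        then have xp: "x\<^sup>\<star> * x = p * p\<^sup>\<star>" using x by simp
        have xp': "x\<^sup>\<star> * (x * (p * r)) = p * r" for r
          using arg_cong[OF xp, of "\<lambda>z. z * (p * r)"] by (simp add: mult.assoc)
        have pq': "p\<^sup>\<star> * (p * r) = q * (q\<^sup>\<star> * r)" for r
          using arg_cong[OF pq, of "\<lambda>z. z * r"] by (simp add: mult.assoc)
        have qt': "q\<^sup>\<star> * (q * r) = t * (t\<^sup>\<star> * r)" for r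
          using arg_cong[OF qt, of "\<lambda>z. z * r"] by (simp add: mult.assoc)
        have px: "p\<^sup>\<star> * (x\<^sup>\<star> * (x * r)) = p\<^sup>\<star> * r" for r
        proof -
          have "p\<^sup>\<star> * (x\<^sup>\<star> * x) = p\<^sup>\<star>" unfolding xp by simp
          from arg_cong[OF this, of "\<lambda>z. z * r"] show ?thesis by (simp add: mult.assoc)
        qed
        have xT: "x \<in> T" "x * x\<^sup>\<star> = e" using x(1) by (auto simp: fibre_def)
        have "x * p * (x * p)\<^sup>\<star> = x * (x\<^sup>\<star> * x) * x\<^sup>\<star>" unfolding xp by (simp add: mult.assoc)
        then have xpL: "x * p * (x * p)\<^sup>\<star> = e" using xT by (simp add: mult.assoc)
        have "x * p * q * (x * p * q)\<^sup>\<star> = x * p * (q * q\<^sup>\<star>) * (x * p)\<^sup>\<star>" by (simp add: mult.assoc)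
        also have "\<dots> = x * p * (x * p)\<^sup>\<star>" unfolding pq[symmetric] by (simp add: mult.assoc)
        finally have xpqL: "x * p * q * (x * p * q)\<^sup>\<star> = e" using xpL by simp
        have "(x * p * q)\<^sup>\<star> * w = q\<^sup>\<star> * (p\<^sup>\<star> * (p * (q * t)))"
          unfolding w_def pqt(4)[symmetric] by (simp add: mult.assoc px)
        also have "\<dots> = t" by (simp add: pq' qt')
        finally have "(x * p * q)\<^sup>\<star> * w = t" .
        moreover have "x\<^sup>\<star> * (x * p) = p" using xp'[of "p\<^sup>\<star> * p"] by simp
        moreover have "(x * p)\<^sup>\<star> * (x * p * q) = q"
          by (simp add: mult.assoc px pq')
        ultimately show ?thesis
          using xpL xpqL xT T mult_T by (simp add: fibre_def)
      qed
      show "\<forall>pqt\<in>?S. ?f (case pqt of (p, q, t) \<Rightarrow> (x * p, x * p * q)) = pqt"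
        using inverse by auto
      show "(\<lambda>(p, q, t). (x * p, x * p * q)) ` ?S \<subseteq> ?L \<times> ?L"
        using inverse by auto
    qed
    have "coeff (a * b * a) s = (\<Sum>(p, q, t)\<in>?S. coeff a p * coeff b q * coeff a t)"
      by (rule coeff_mult_mult[OF fin(1) a supp_b a])
    also have "\<dots> = (\<Sum>(y, z)\<in>?L \<times> ?L. coeff a (x\<^sup>\<star> * y) * coeff b (y\<^sup>\<star> * z) * coeff a (z\<^sup>\<star> * w))"
      using sum.reindex_bij_betw[OF bij, of "\<lambda>(p, q, t). coeff a p * coeff b q * coeff a t"]
      by (simp add: case_prod_unfold)
    also have "\<dots> = (\<Sum>(y, z)\<in>?L \<times> ?L. u * (\<Sum>g\<in>?G. A x y * X (g * y) (g * z) * A z w))"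
    proof (rule sum.cong[OF refl], clarify)
      fix y z assume yz: "y \<in> ?L" "z \<in> ?L"
      have "coeff a (x\<^sup>\<star> * y) * coeff b (y\<^sup>\<star> * z) * coeff a (z\<^sup>\<star> * w) =
          A x y * u * (\<Sum>g\<in>?G. X (g * y) (g * z)) * A z w"
        using yz x w L_D by (simp add: A_def b average mult.assoc)
      then show "coeff a (x\<^sup>\<star> * y) * coeff b (y\<^sup>\<star> * z) * coeff a (z\<^sup>\<star> * w) =
          u * (\<Sum>g\<in>?G. A x y * X (g * y) (g * z) * A z w)"
        unfolding central[symmetric] by (simp add: sum_distrib_left sum_distrib_right mult.assoc)
    qed
    also have "\<dots> = u * (\<Sum>g\<in>?G. \<Sum>(y, z)\<in>?L \<times> ?L. A x y * X (g * y) (g * z) * A z w)"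
      by (subst sum.swap) (simp add: sum_distrib_left case_prod_unfold)
    also have "(\<Sum>g\<in>?G. \<Sum>(y, z)\<in>?L \<times> ?L. A x y * X (g * y) (g * z) * A z w) = (\<Sum>g\<in>?G. coeff a s)"
    proof (rule sum.cong[OF refl])
      fix g assume g: "g \<in> ?G"
      note bij_g = bij_betw_H_class_translation[OF g]
      \<comment> \<open>Invariance puts \<open>g\<close> into both factors \<open>A\<close>.
        Translation by \<open>g\<close> permutes the fibre, so the shifts of \<open>y\<close> and
        \<open>z\<close> disappear and the quasi-inverse equation applies at
        \<open>(g * x, g * w)\<close>.\<close>
      have "(\<Sum>(y, z)\<in>?L \<times> ?L. A x y * X (g * y) (g * z) * A z w) =
          (\<Sum>z\<in>?L. \<Sum>y\<in>?L. A (g * x) (g * y) * X (g * y) (g * z) * A (g * z) (g * w))"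
        unfolding sum.cartesian_product[symmetric]
        by (subst sum.swap) (simp add: invariant g x w)
      also have "\<dots> = (\<Sum>z\<in>?L. \<Sum>y\<in>?L. A (g * x) y * X y (g * z) * A (g * z) (g * w))"
        by (intro sum.cong[OF refl] sum.reindex_bij_betw[OF bij_g])
      also have "\<dots> = (\<Sum>z\<in>?L. \<Sum>y\<in>?L. A (g * x) y * X y z * A z (g * w))"
        by (rule sum.reindex_bij_betw[OF bij_g])
      also have "\<dots> = mat_mult ?L (mat_mult ?L A X) A (g * x) (g * w)"
        by (simp add: mat_mult_def sum_distrib_right)
      also have "\<dots> = coeff a s"
        unfolding X using invariant[OF g x(1) w] x(1) w by (simp add: A_def xw)
      finally show "(\<Sum>(y, z)\<in>?L \<times> ?L. A x y * X (g * y) (g * z) * A z w) = coeff a s" .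
    qed
    also have "u * (\<Sum>g\<in>?G. coeff a s) = coeff a s"
      by (simp add: u flip: mult.assoc)
    finally show ?thesis .
  qed
  have I_mult: "s * t \<in> I" if "s \<in> I" "t \<in> I" for s t
    using I(1) that unfolding ideal_in_def by blast
  have "supp (a * b * a) \<subseteq> I"
    using supp_mult[of "a * b" a] supp_mult[of a b] a supp_b I_mult by blast
  then have "supp (a - a * b * a) \<subseteq> I - ?D"
    using a coeff_D by (auto simp: in_keys_iff lookup_minus) (metis diff_self in_keys_iff subsetD)+
  then show ?thesis ..
qed

text \<open>Stated for all ideals of \<open>T\<close> so that the induction reaches the ideal left
  after removing a D-class.\<close>

lemma regular_on_ideal:
  fixes a :: "('s, 'r::ring_1) semigroup_ring"
  assumes reg: "von_neumann_regular TYPE('r)"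
    and inv: "\<And>G::'s set. subgroup_of_semigroup G \<Longrightarrow> finite G \<Longrightarrow>
      \<exists>u::'r. of_nat (card G) * u = 1 \<and> u * of_nat (card G) = 1"
    and I: "ideal_in T I" and a: "supp a \<subseteq> I"
  shows "\<exists>b. a * b * a = a"
proof -
  have "finite I" using I finite_T finite_subset unfolding ideal_in_def by blast
  then show ?thesis using I a
  proof (induction I arbitrary: a rule: finite_psubset_induct)
    case (psubset I)
    show ?case
    proof (cases "I = {}")
      case True
      then have "coeff a s = 0" for s using psubset.prems by (simp add: in_keys_iff)
      then have "a = 0" by (intro semigroup_ring_eqI) simp
      then show ?thesis by simp
    next
      case False
      from ideal_maximal_D_class[OF psubset.prems(1) False] obtain e where
        e: "e * e = e" "e \<in> T" "e \<in> D_class T e" "D_class T e \<subseteq> I" "ideal_in T (I - D_class T e)"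
        and comp: "\<And>s t. s \<in> D_class T e \<Longrightarrow> t \<in> T \<Longrightarrow> s * t \<in> D_class T e \<Longrightarrow> s * (t * t\<^sup>\<star>) = s"
        by blast
      have "finite (H_class e)" using finite_T by (simp add: H_class_def)
      with inv[OF subgroup_H_class[OF e(1,2)]] obtain u :: 'r where
        u: "of_nat (card (H_class e)) * u = 1" "u * of_nat (card (H_class e)) = 1" by blast
      obtain b where b: "supp (a - a * b * a) \<subseteq> I - D_class T e"
        using quasi_inverse_modulo_ideal[OF reg e(1,2,4) psubset.prems(1) e(5) comp u psubset.prems(2)]
        by blast
      have "I - D_class T e \<subset> I" using e(3,4) by blast
      then obtain c where "(a - a * b * a) * c * (a - a * b * a) = a - a * b * a"
        using psubset.IH e(5) b by blast
      then show ?thesis by (rule regular_if_difference_regular)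
    qed
  qed
qed

end

lemma regular_if_locally_finite:
  assumes reg: "von_neumann_regular TYPE('r)"
    and fin: "locally_finite_semigroup TYPE('s)"
    and inv: "\<And>G::'s set. subgroup_of_semigroup G \<Longrightarrow> finite G \<Longrightarrow>
      \<exists>u::'r. of_nat (card G) * u = 1 \<and> u * of_nat (card G) = 1"
  shows "von_neumann_regular TYPE(('s::inverse_semigroup, 'r::ring_1) semigroup_ring)"
  unfolding von_neumann_regular_def
proof
  fix a :: "('s, 'r) semigroup_ring"
  \<comment> \<open>Closing the support under inversion makes the generated subsemigroup an inverse
    one.\<close>
  let ?A = "supp a \<union> star ` supp a"
  let ?T = "generated_subsemigroup ?A"
  interpret finite_inverse_subsemigroup ?T
  proof
    show "finite ?T" using fin by (simp add: locally_finite_semigroup_def)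
    show "s * t \<in> ?T" if "s \<in> ?T" "t \<in> ?T" for s t
      using that by (rule generated_subsemigroup.mult)
    show "s\<^sup>\<star> \<in> ?T" if "s \<in> ?T" for s
      using that by (intro generated_subsemigroup_star) auto
  qed
  have "ideal_in ?T ?T" using mult_T by (simp add: ideal_in_def)
  moreover have "supp a \<subseteq> ?T" by (auto intro: generated_subsemigroup.generator)
  ultimately show "\<exists>b. a * b * a = a" using regular_on_ideal[OF reg] inv by blast
qed

theorem theoremB:
  shows "von_neumann_regular TYPE(('s::inverse_semigroup, 'r::ring_1) semigroup_ring) \<longleftrightarrow>
    von_neumann_regular TYPE('r) \<and>
    locally_finite_semigroup TYPE('s) \<and>
    (\<forall>G::'s set. subgroup_of_semigroup G \<and> finite G \<longrightarrow>
      (\<exists>u::'r. of_nat (card G) * u = 1 \<and> u * of_nat (card G) = 1))"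
  using von_neumann_regular_coefficients locally_finite_if_regular card_subgroup_invertible
    regular_if_locally_finite by blast

end
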